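(* Let $p\in[0,1]$, $q:=1-p$, let $k\ge 3$ be an integer, $\lambda_k:=2\cos(\pi/k)$, and let $m_n:=\mathbb{E}(g_n)$ be the expected value of the $n$-th term of a $(p,\lambda_k)$-random Fibonacci sequence $(g_n)_{n\ge1}$ with positive initial terms $g_1,g_2$. Set $p_c:=(2-\lambda_k)/4$. \begin{itemize} \item If $p>p_c$, then $$\lim_{n\to\infty}\frac{m_{n+1}}{m_n}=\alpha_k(p)\left(1+\frac{pq^{k-1}}{\alpha_k(p)^k}\right)>1,$$ where $\alpha_k(p)$ is the only positive real root of the polynomial $$P_k(X):=X^{2k}-\lambda_kX^{2k-1}-(2p-1)X^{2k-2}-\lambda_kpq^{k-1}X^{k-1}-p^2q^{2k-2}.$$ \item If $p=p_c$, then $(m_n)_n$ grows at most linearly, i.e. $m_n=O(n)$. \item If $p<p_c$, then $(m_n)_n$ is bounded. \end{itemize}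
   Context: For $p\in[0,1]$ and a real number $\lambda$, a $(p,\lambda)$-random Fibonacci sequence is a random sequence $(g_n)_{n\ge1}$ whose first two terms $g_1,g_2$ are fixed (deterministic) positive real numbers and which satisfies, for $n\ge3$, $g_n=|\lambda g_{n-1}\pm g_{n-2}|$, where for each $n$ the $\pm$ sign is chosen by an independent coin toss: $+$ with probability $p$ and $-$ with probability $q=1-p$. *)

theory Defs
  imports "HOL-Probability.Probability" "HOL-Computational_Algebra.Polynomial"
begin

(* The sequence is indexed from 1; g 0 is left unconstrained. *)
definition random_fibonacci ::
  "'a measure \<Rightarrow> real \<Rightarrow> real \<Rightarrow> (nat \<Rightarrow> 'a \<Rightarrow> real) \<Rightarrow> bool"
where
  "random_fibonacci M p l g \<longleftrightarrow>
     prob_space M \<and>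
     (\<exists>a b. 0 < a \<and> 0 < b \<and> (\<forall>\<omega>\<in>space M. g 1 \<omega> = a \<and> g 2 \<omega> = b)) \<and>
     (\<exists>plus :: nat \<Rightarrow> 'a \<Rightarrow> bool.
        prob_space.indep_vars M (\<lambda>_. count_space UNIV) plus {3..} \<and>
        (\<forall>n\<ge>3. measure M {\<omega> \<in> space M. plus n \<omega>} = p) \<and>
        (\<forall>n\<ge>3. \<forall>\<omega>\<in>space M.
           g n \<omega> = (if plus n \<omega> then \<bar>l * g (n - 1) \<omega> + g (n - 2) \<omega>\<bar>
                    else \<bar>l * g (n - 1) \<omega> - g (n - 2) \<omega>\<bar>)))"

definition fib_lambda :: "nat \<Rightarrow> real" where
  "fib_lambda k = 2 * cos (pi / real k)"

definition fib_crit :: "nat \<Rightarrow> real" where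
  "fib_crit k = (2 - fib_lambda k) / 4"

definition fib_poly :: "nat \<Rightarrow> real \<Rightarrow> real poly" where
  "fib_poly k p =
     monom 1 (2 * k)
     - monom (fib_lambda k) (2 * k - 1)
     - monom (2 * p - 1) (2 * k - 2)
     - monom (fib_lambda k * p * (1 - p) ^ (k - 1)) (k - 1)
     - monom (p\<^sup>2 * (1 - p) ^ (2 * k - 2)) 0"

end

theory Submission
  imports Defs "HOL-Computational_Algebra.Formal_Power_Series"
begin

text \<open>
  On pairs of consecutive terms, a \<open>+\<close> toss followed by \<open>k - 1\<close> tosses \<open>-\<close> acts as the identity,
  because for \<open>\<lambda> = 2 cos (\<pi> / k)\<close> the linear \<open>-\<close> step is a rotation by \<open>\<pi> / k\<close> and absolute values
  intervene only at its last step. Deleting such blocks reduces every word of tosses to a run of \<open>-\<close>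
  (bounded orbit) followed by blocks \<open>+ -^j\<close> with \<open>j \<le> k - 2\<close>, which act linearly with nonnegative
  entries. Hence the generating function of the expectations is explicit in terms of the series \<open>u\<close> with
  \<open>u = z (1 + p q^(k-1) u^k)\<close>, and it satisfies a renewal equation \<open>G = b + d G\<close> with nonnegative
  coefficients. The equation \<open>d = 1\<close> reads \<open>P\<^sub>k (1 / u) = 0\<close>. Above \<open>p\<^sub>c\<close> it has a root before
  the branch point of \<open>u\<close> and with \<open>z < 1\<close>, and a renewal theorem gives the growth rate \<open>1 / z\<close>; at
  \<open>z = 1\<close>, that is \<open>u = 1 / q\<close>, the value of \<open>d\<close> is \<open>1\<close> for \<open>p = p\<^sub>c\<close> and smaller than \<open>1\<close> below.
\<close>

section \<open>A renewal theorem\<close>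

text \<open>The triangle \<open>i + j < N\<close> sits inside the square. This bounds partial sums
  of products of series whose convergence is still open.\<close>

lemma sum_convolution_le:
  fixes a b :: "nat \<Rightarrow> real"
  assumes "\<And>n. 0 \<le> a n" "\<And>n. 0 \<le> b n"
  shows "(\<Sum>n<N. \<Sum>i\<le>n. a i * b (n - i)) \<le> sum a {..<N} * sum b {..<N}"
proof -
  have "(\<Sum>n<N. \<Sum>i\<le>n. a i * b (n - i)) = (\<Sum>(i,j)\<in>{(i,j). i + j < N}. a i * b j)"
    by (subst sum.triangle_reindex) simp
  also have "\<dots> \<le> (\<Sum>(i,j)\<in>{..<N} \<times> {..<N}. a i * b j)"
    by (rule sum_mono2) (auto simp: assms)
  also have "\<dots> = sum a {..<N} * sum b {..<N}"
    by (simp add: sum_product sum.cartesian_product)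
  finally show ?thesis .
qed

text \<open>\<open>d\<close> is a waiting-time distribution; \<open>d_1\<close> makes it aperiodic,
  and the exponential moment \<open>d_exp\<close> makes its tails summable.\<close>

locale renewal =
  fixes d b f :: "nat \<Rightarrow> real" and \<beta> x :: real
  assumes d_nonneg: "\<And>n. 0 \<le> d n" and d_sums: "d sums 1" and d_0: "d 0 = 0" and d_1: "0 < d 1"
    and d_exp: "1 < x" "summable (\<lambda>n. d n * x ^ n)"
    and b_nonneg: "\<And>n. 0 \<le> b n" and b_sums: "b sums \<beta>" and \<beta>_pos: "0 < \<beta>"
    and f_eq: "\<And>n. f n = b n + (\<Sum>j\<le>n. d j * f (n - j))"
begin

definition T :: "nat \<Rightarrow> real" where "T n = 1 - (\<Sum>j\<le>n. d j)"

lemma f_eq0: "f n = b n + (\<Sum>j<n. d (Suc j) * f (n - Suc j))"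
proof -
  have "(\<Sum>j\<le>n. d j * f (n - j)) = d 0 * f n + (\<Sum>j<n. d (Suc j) * f (n - Suc j))"
    by (subst sum.atMost_shift) simp
  then show ?thesis using f_eq[of n] d_0 by simp
qed

lemma f_nonneg: "0 \<le> f n"
proof (induction n rule: less_induct)
  case (less n)
  show ?case
    by (subst f_eq0) (intro add_nonneg_nonneg sum_nonneg mult_nonneg_nonneg b_nonneg d_nonneg less; simp)
qed

lemma T_0: "T 0 = 1" by (simp add: T_def d_0)

lemma T_Suc: "T (Suc n) = T n - d (Suc n)" by (simp add: T_def)

lemma d_sum_le: "sum d {..n} \<le> 1"
  using sum_le_suminf[OF sums_summable[OF d_sums], of "{..n}"] d_nonneg sums_unique[OF d_sums] by simp

lemma T_nonneg: "0 \<le> T n" using d_sum_le by (simp add: T_def)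

text \<open>Markov's inequality for the weight \<open>x ^ j\<close>: the tail \<open>T n\<close> is
  at most \<open>C / x ^ n\<close>.\<close>

lemma summable_T: "summable T"
proof (rule summable_comparison_test)
  define C where "C = (\<Sum>n. d n * x ^ n)"
  have "T n \<le> C * (1 / x) ^ n" for n
  proof -
    have s1: "(\<lambda>j. d (j + Suc n)) sums T n"
      using sums_split_initial_segment[OF d_sums, of "Suc n"] by (simp add: T_def lessThan_Suc_atMost)
    have s2: "(\<lambda>j. d (j + Suc n) * x ^ (j + Suc n)) sums (C - (\<Sum>j<Suc n. d j * x ^ j))"
      unfolding C_def using sums_split_initial_segment[OF summable_sums[OF d_exp(2)], of "Suc n"] by simp
    have s3: "(\<lambda>j. x ^ n * d (j + Suc n)) sums (x ^ n * T n)"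
      using s1 by (rule sums_mult)
    have "x ^ n * T n \<le> C - (\<Sum>j<Suc n. d j * x ^ j)"
    proof (rule sums_le[OF _ s3 s2])
      fix j
      have "x ^ n \<le> x ^ (j + Suc n)" using d_exp(1) by (intro power_increasing) auto
      then show "x ^ n * d (j + Suc n) \<le> d (j + Suc n) * x ^ (j + Suc n)"
        using mult_left_mono[OF _ d_nonneg[of "j + Suc n"], of "x ^ n" "x ^ (j + Suc n)"] by (simp add: mult.commute)
    qed
    also have "\<dots> \<le> C"
      using sum_nonneg[of "{..<Suc n}" "\<lambda>j. d j * x ^ j"] d_nonneg d_exp(1) by simp
    finally show ?thesis using d_exp(1) by (simp add: field_simps power_one_over)
  qed
  then show "\<exists>N. \<forall>n\<ge>N. norm (T n) \<le> C * (1 / x) ^ n" using T_nonneg by simp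
  show "summable (\<lambda>n. C * (1 / x) ^ n)"
    using d_exp(1) by (intro summable_mult summable_geometric) simp
qed

text \<open>Summation by parts. The sequence \<open>F\<close> is arbitrary because both
  \<open>f\<close> and its square are inserted.\<close>

lemma T_convolution_Suc:
  fixes F :: "nat \<Rightarrow> real"
  shows "(\<Sum>j\<le>Suc n. T j * F (Suc n - j)) =
    (\<Sum>j\<le>n. T j * F (n - j)) + F (Suc n) - (\<Sum>j\<le>Suc n. d j * F (Suc n - j))"
  unfolding sum.atMost_Suc_shift[of "\<lambda>j. T j * F (Suc n - j)"] sum.atMost_Suc_shift[of "\<lambda>j. d j * F (Suc n - j)"]
  by (simp add: T_0 T_Suc d_0 left_diff_distrib sum_subtractf)

lemma T_convolution_f: "(\<Sum>j\<le>n. T j * f (n - j)) = (\<Sum>i\<le>n. b i)"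
proof (induction n)
  case 0
  show ?case using f_eq[of 0] by (simp add: T_0 d_0)
next
  case (Suc n)
  then show ?case using f_eq[of "Suc n"] T_convolution_Suc[of f n] by simp
qed

lemma b_sum_le: "sum b {..n} \<le> \<beta>"
  using sum_le_suminf[OF sums_summable[OF b_sums], of "{..n}"] b_nonneg sums_unique[OF b_sums] by simp

lemma f_le: "f n \<le> \<beta>"
proof -
  have "T 0 * f (n - 0) \<le> (\<Sum>j\<le>n. T j * f (n - j))"
    by (rule member_le_sum) (auto simp: T_nonneg f_nonneg)
  then show ?thesis using b_sum_le[of n] by (simp add: T_0 T_convolution_f)
qed

text \<open>By the variance identity the energy \<open>\<Sum>j\<le>n. T j * (f (n - j))\<^sup>2\<close> can only decrease, up to
  summable errors, and it drops by at least \<open>d 1\<close> times the squared increment.\<close>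

lemma increment_tendsto_0: "(\<lambda>n. f (Suc n) - f n) \<longlonglongrightarrow> 0"
proof -
  define V where "V n = (\<Sum>j\<le>n. T j * (f (n - j))\<^sup>2)" for n
  define m where "m n = (\<Sum>j\<le>n. d j * f (n - j))" for n
  have m: "f n = b n + m n" for n unfolding m_def by (rule f_eq)
  have step: "d 1 * (f n - m (Suc n))\<^sup>2 \<le> V n - V (Suc n) + 2 * \<beta> * b (Suc n)" for n
  proof -
    let ?N = "Suc n"
    \<comment> \<open>Only the term \<open>j = 1\<close> of the variance about \<open>m ?N\<close>
      is kept; it is the one that compares consecutive values.\<close>
    have "d 1 * (f (?N - 1) - m ?N)\<^sup>2 \<le> (\<Sum>j\<le>?N. d j * (f (?N - j) - m ?N)\<^sup>2)"
      by (rule member_le_sum[where f = "\<lambda>j. d j * (f (?N - j) - m ?N)\<^sup>2"]) (auto simp: d_nonneg)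
    also have "\<dots> = (\<Sum>j\<le>?N. d j * (f (?N - j))\<^sup>2 - 2 * m ?N * (d j * f (?N - j)) + (m ?N)\<^sup>2 * d j)"
      by (rule sum.cong) (auto simp: power2_eq_square algebra_simps)
    also have "\<dots> = (\<Sum>j\<le>?N. d j * (f (?N - j))\<^sup>2) - 2 * m ?N * m ?N + (m ?N)\<^sup>2 * (\<Sum>j\<le>?N. d j)"
      by (simp only: sum.distrib sum_subtractf sum_distrib_left[symmetric] m_def)
    also have "\<dots> \<le> (\<Sum>j\<le>?N. d j * (f (?N - j))\<^sup>2) - (m ?N)\<^sup>2"
      using mult_left_mono[OF d_sum_le[of ?N], of "(m ?N)\<^sup>2"] by (simp add: power2_eq_square)
    finally have 1: "d 1 * (f n - m ?N)\<^sup>2 \<le> (\<Sum>j\<le>?N. d j * (f (?N - j))\<^sup>2) - (m ?N)\<^sup>2" by simp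
    have "(f ?N)\<^sup>2 = (m ?N)\<^sup>2 + b ?N * (f ?N + m ?N)"
      unfolding m[of ?N] by (simp add: power2_eq_square algebra_simps)
    also have "b ?N * (f ?N + m ?N) \<le> b ?N * (2 * \<beta>)"
      using f_le[of ?N] m[of ?N] b_nonneg[of ?N] by (intro mult_left_mono) auto
    finally have "(f ?N)\<^sup>2 \<le> (m ?N)\<^sup>2 + 2 * \<beta> * b ?N" by (simp add: mult_ac)
    with 1 show ?thesis
      using T_convolution_Suc[of "\<lambda>i. (f i)\<^sup>2" n] by (simp add: V_def)
  qed
  have V0: "0 \<le> V n" for n by (simp add: V_def sum_nonneg T_nonneg)
  \<comment> \<open>\<open>V\<close> telescopes, so the squared deviations have bounded partial
    sums.\<close>
  have "(\<Sum>n<N. d 1 * (f n - m (Suc n))\<^sup>2) \<le> V 0 + 2 * \<beta> * \<beta>" for N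
  proof -
    have "(\<Sum>n<N. d 1 * (f n - m (Suc n))\<^sup>2) \<le> (\<Sum>n<N. V n - V (Suc n) + 2 * \<beta> * b (Suc n))"
      by (rule sum_mono[OF step])
    also have "\<dots> = V 0 - V N + 2 * \<beta> * (\<Sum>n<N. b (Suc n))"
      by (simp add: sum.distrib sum_lessThan_telescope' sum_distrib_left)
    also have "(\<Sum>n<N. b (Suc n)) \<le> \<beta>"
    proof -
      have "(\<Sum>n<N. b (Suc n)) \<le> sum b {..N}"
        using b_nonneg[of 0] by (simp add: sum.atMost_shift)
      then show ?thesis using b_sum_le[of N] by simp
    qed
    then have "V 0 - V N + 2 * \<beta> * (\<Sum>n<N. b (Suc n)) \<le> V 0 + 2 * \<beta> * \<beta>"
      using V0[of N] \<beta>_pos by (intro add_mono mult_left_mono) auto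
    finally show ?thesis by simp
  qed
  from this[of "Suc _"] have "summable (\<lambda>n. d 1 * (f n - m (Suc n))\<^sup>2)"
    using d_nonneg by (intro bounded_imp_summable[where B = "V 0 + 2 * \<beta> * \<beta>"])
      (auto simp only: lessThan_Suc_atMost zero_le_power2 intro: mult_nonneg_nonneg)
  then have "(\<lambda>n. d 1 * (f n - m (Suc n))\<^sup>2) \<longlonglongrightarrow> 0" by (rule summable_LIMSEQ_zero)
  then have "(\<lambda>n. (1 / d 1) * (d 1 * (f n - m (Suc n))\<^sup>2)) \<longlonglongrightarrow> 0"
    by (rule tendsto_mult_right_zero)
  then have "(\<lambda>n. (f n - m (Suc n))\<^sup>2) \<longlonglongrightarrow> 0" using d_1 by simp
  then have 1: "(\<lambda>n. f n - m (Suc n)) \<longlonglongrightarrow> 0"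
    using tendsto_real_sqrt[of "\<lambda>n. (f n - m (Suc n))\<^sup>2" 0] by (simp add: tendsto_rabs_zero_iff)
  have "(\<lambda>n. b (Suc n)) \<longlonglongrightarrow> 0"
    using summable_LIMSEQ_zero[OF sums_summable[OF b_sums]] by (rule LIMSEQ_Suc)
  from tendsto_diff[OF this 1] show ?thesis by (simp add: m[of "Suc _"] algebra_simps)
qed

lemma shift_tendsto_0: "(\<lambda>n. f (n - j) - f n) \<longlonglongrightarrow> 0"
proof (induction j)
  case (Suc j)
  have 1: "filterlim (\<lambda>n. n - Suc j) at_top at_top"
    by (rule filterlim_minus_const_nat_at_top)
  have "(\<lambda>n. f (Suc (n - Suc j)) - f (n - Suc j)) \<longlonglongrightarrow> 0"
    using filterlim_compose[OF increment_tendsto_0 1] .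
  then have "(\<lambda>n. f (n - j) - f (n - Suc j)) \<longlonglongrightarrow> 0"
    by (rule Lim_transform_eventually) (use eventually_ge_at_top[of "Suc j"] in eventually_elim, simp add: Suc_diff_Suc)
  from tendsto_diff[OF Suc this] show ?case by simp
qed simp

text \<open>By \<open>shift_tendsto_0\<close>, the identity \<open>T_convolution_f\<close> says in
  the limit that \<open>f n\<close> times the mean \<open>suminf T\<close> equals
  \<open>\<beta>\<close>. Tannery's theorem justifies the interchange of limits.\<close>

lemma renewal_limit: "\<exists>c>0. f \<longlonglongrightarrow> c"
proof -
  have \<mu>: "1 \<le> suminf T"
    using sum_le_suminf[OF summable_T, of "{0}"] T_nonneg T_0 by simp
  \<comment> \<open>Cutting \<open>h\<close> off at \<open>j = n\<close> turns the finite
    convolution into a full series, dominated by \<open>T j * \<beta>\<close>.\<close>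
  define h where "h j n = (if j \<le> n then T j * (f (n - j) - f n) else 0)" for j n
  have lim: "(\<lambda>n. h j n) \<longlonglongrightarrow> 0" for j
  proof -
    have "(\<lambda>n. T j * (f (n - j) - f n)) \<longlonglongrightarrow> 0"
      by (rule tendsto_mult_right_zero[OF shift_tendsto_0])
    then show ?thesis
      by (rule Lim_transform_eventually)
        (use eventually_ge_at_top[of j] in eventually_elim, simp add: h_def)
  qed
  have bound: "norm (h j n) \<le> T j * \<beta>" for j n
  proof -
    have "\<bar>f (n - j) - f n\<bar> \<le> \<beta>" using f_nonneg f_le by (smt (verit))
    then show ?thesis using T_nonneg[of j] \<beta>_pos by (simp add: h_def abs_mult mult_left_mono)
  qed
  have "(\<lambda>n. \<Sum>j. h j n) \<longlonglongrightarrow> (\<Sum>j. (0::real))"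
    using tannerys_theorem[of h "\<lambda>_. 0" sequentially "\<lambda>j. T j * \<beta>", OF lim
        always_eventually summable_mult2[OF summable_T] sequentially_bot] bound by auto
  moreover have "(\<Sum>j. h j n) = sum b {..n} - f n * sum T {..n}" for n
  proof -
    have "(\<Sum>j. h j n) = (\<Sum>j\<le>n. h j n)" by (rule suminf_finite) (auto simp: h_def)
    also have "\<dots> = (\<Sum>j\<le>n. T j * f (n - j) - f n * T j)"
      by (rule sum.cong) (auto simp: h_def algebra_simps)
    also have "\<dots> = (\<Sum>j\<le>n. T j * f (n - j)) - f n * sum T {..n}"
      by (simp add: sum_subtractf sum_distrib_left)
    finally show ?thesis by (simp add: T_convolution_f)
  qed
  ultimately have "(\<lambda>n. sum b {..n} - f n * sum T {..n}) \<longlonglongrightarrow> 0" by simp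
  moreover have "(\<lambda>n. sum b {..n}) \<longlonglongrightarrow> \<beta>" using b_sums by (simp add: sums_def_le)
  ultimately have "(\<lambda>n. sum b {..n} - (sum b {..n} - f n * sum T {..n})) \<longlonglongrightarrow> \<beta> - 0"
    by (intro tendsto_diff)
  moreover have "(\<lambda>n. sum T {..n}) \<longlonglongrightarrow> suminf T"
    using summable_sums[OF summable_T] by (simp add: sums_def_le)
  ultimately have "(\<lambda>n. f n * sum T {..n} / sum T {..n}) \<longlonglongrightarrow> \<beta> / suminf T"
    using \<mu> by (intro tendsto_divide) auto
  moreover have "sum T {..n} \<noteq> 0" for n
    using member_le_sum[of 0 "{..n}" T] T_nonneg T_0 by auto
  ultimately have "f \<longlonglongrightarrow> \<beta> / suminf T" by simp
  moreover have "0 < \<beta> / suminf T" using \<mu> \<beta>_pos by simp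
  ultimately show ?thesis by blast
qed

end

section \<open>Power series with nonnegative coefficients\<close>

unbundle no vec_syntax
unbundle fps_syntax

definition fps_nonneg :: "real fps \<Rightarrow> bool" where
  "fps_nonneg f \<longleftrightarrow> (\<forall>n. 0 \<le> f $ n)"

text \<open>Nonnegativity is bundled in: convergence then follows from bounded partial sums, and
  Cauchy products converge without further hypotheses.\<close>

definition fps_sums :: "real \<Rightarrow> real fps \<Rightarrow> real \<Rightarrow> bool" where
  "fps_sums x f c \<longleftrightarrow> fps_nonneg f \<and> 0 \<le> x \<and> (\<lambda>n. f $ n * x ^ n) sums c"

lemma fps_nonnegD: "fps_nonneg f \<Longrightarrow> 0 \<le> f $ n"
  by (simp add: fps_nonneg_def)

lemma fps_nonneg_add: "fps_nonneg f \<Longrightarrow> fps_nonneg g \<Longrightarrow> fps_nonneg (f + g)"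
  by (simp add: fps_nonneg_def)

lemma fps_nonneg_mult: "fps_nonneg f \<Longrightarrow> fps_nonneg g \<Longrightarrow> fps_nonneg (f * g)"
  by (simp add: fps_nonneg_def fps_mult_nth sum_nonneg)

lemma fps_nonneg_const: "0 \<le> c \<Longrightarrow> fps_nonneg (fps_const c)"
  by (simp add: fps_nonneg_def fps_const_def)

lemma fps_nonneg_power: "fps_nonneg f \<Longrightarrow> fps_nonneg (f ^ k)"
  using fps_nonneg_const[of 1] by (induction k) (auto intro: fps_nonneg_mult)

lemma fps_nonneg_sum: "(\<And>i. i \<in> A \<Longrightarrow> fps_nonneg (f i)) \<Longrightarrow> fps_nonneg (sum f A)"
  by (simp add: fps_nonneg_def fps_sum_nth sum_nonneg)

lemma fps_nonneg_solution:
  assumes "f = b + d * f" "fps_nonneg b" "fps_nonneg d" "d $ 0 = 0"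
  shows "fps_nonneg f"
proof -
  have "0 \<le> f $ n" for n
  proof (induction n rule: less_induct)
    case (less n)
    have "0 \<le> (\<Sum>i=0..n. d $ i * f $ (n - i))"
    proof (rule sum_nonneg)
      fix i assume "i \<in> {0..n}"
      then show "0 \<le> d $ i * f $ (n - i)"
        using less[of "n - i"] assms by (cases "i = 0") (auto simp: fps_nonneg_def)
    qed
    then have "0 \<le> b $ n + (d * f) $ n"
      using assms by (simp add: fps_mult_nth fps_nonneg_def)
    then show ?case using assms(1) by (metis fps_add_nth)
  qed
  then show ?thesis by (simp add: fps_nonneg_def)
qed

lemma fps_sums_unique: "fps_sums x f c \<Longrightarrow> fps_sums x f c' \<Longrightarrow> c = c'"
  unfolding fps_sums_def using sums_unique2 by blast

lemma fps_sums_partial: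
  assumes "fps_sums x f c"
  shows "(\<Sum>n<N. f $ n * x ^ n) \<le> c"
proof -
  have "(\<Sum>n<N. f $ n * x ^ n) \<le> (\<Sum>n. f $ n * x ^ n)"
    using assms by (intro sum_le_suminf) (auto simp: fps_sums_def fps_nonneg_def sums_iff)
  then show ?thesis using assms by (simp add: fps_sums_def sums_iff)
qed

lemma fps_sums_ge0: "fps_sums x f c \<Longrightarrow> 0 \<le> c"
  using fps_sums_partial[of x f c 0] by simp

lemma fps_sums_of_partial:
  assumes "fps_nonneg f" "0 \<le> x" "\<And>N. (\<Sum>n<N. f $ n * x ^ n) \<le> c"
  obtains t where "fps_sums x f t" "t \<le> c"
proof -
  have "summable (\<lambda>n. f $ n * x ^ n)"
    using assms(1,2) assms(3)[of "Suc _"] by (intro bounded_imp_summable[where B = c])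
      (auto simp only: fps_nonneg_def lessThan_Suc_atMost intro: mult_nonneg_nonneg zero_le_power)
  then obtain t where t: "(\<lambda>n. f $ n * x ^ n) sums t" by (auto simp: summable_def)
  have "t \<le> c"
    using t assms(3) unfolding sums_def by (intro LIMSEQ_le_const2) auto
  with t assms that show thesis by (auto simp: fps_sums_def)
qed

lemma fps_sums_const: "0 \<le> c \<Longrightarrow> 0 \<le> x \<Longrightarrow> fps_sums x (fps_const c) c"
proof -
  assume a: "0 \<le> c" "0 \<le> x"
  have "(\<lambda>n. fps_const c $ n * x ^ n) sums (\<Sum>n\<in>{0}. fps_const c $ n * x ^ n)"
    by (rule sums_finite) auto
  then show ?thesis using a by (simp add: fps_sums_def fps_nonneg_const)
qed

lemma fps_sums_1: "0 \<le> x \<Longrightarrow> fps_sums x 1 1"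
  using fps_sums_const[of 1 x] by simp

lemma fps_sums_X: "0 \<le> x \<Longrightarrow> fps_sums x fps_X x"
proof -
  assume a: "0 \<le> x"
  have "(\<lambda>n. fps_X $ n * x ^ n) sums (\<Sum>n\<in>{1}. fps_X $ n * x ^ n)"
    by (rule sums_finite) (auto simp: fps_X_def)
  then show ?thesis using a by (simp add: fps_sums_def fps_nonneg_def fps_X_def)
qed

lemma fps_sums_add: "fps_sums x f c \<Longrightarrow> fps_sums x g c' \<Longrightarrow> fps_sums x (f + g) (c + c')"
  using sums_add by (fastforce simp: fps_sums_def fps_nonneg_add distrib_right)

lemma fps_mult_nth_scaled:
  fixes f g :: "real fps"
  shows "(f * g) $ n * x ^ n = (\<Sum>i\<le>n. (f $ i * x ^ i) * (g $ (n - i) * x ^ (n - i)))"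
  unfolding fps_mult_nth atLeast0AtMost sum_distrib_right
proof (rule sum.cong[OF refl])
  fix i assume "i \<in> {..n}"
  then have "x ^ n = x ^ i * x ^ (n - i)" by (simp add: power_add[symmetric])
  then show "f $ i * g $ (n - i) * x ^ n = f $ i * x ^ i * (g $ (n - i) * x ^ (n - i))" by simp
qed

lemma fps_sums_mult:
  assumes "fps_sums x f c" "fps_sums x g c'"
  shows "fps_sums x (f * g) (c * c')"
proof -
  have s: "(\<lambda>n. f $ n * x ^ n) sums c" "(\<lambda>n. g $ n * x ^ n) sums c'" and n: "fps_nonneg f" "fps_nonneg g" "0 \<le> x"
    using assms by (auto simp: fps_sums_def)
  have "(\<lambda>n. \<Sum>i\<le>n. (f $ i * x ^ i) * (g $ (n - i) * x ^ (n - i))) sums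
      ((\<Sum>n. f $ n * x ^ n) * (\<Sum>n. g $ n * x ^ n))"
    by (rule Cauchy_product_sums) (use s n in \<open>auto simp: fps_nonneg_def sums_iff\<close>)
  then show ?thesis using s n by (simp add: fps_sums_def fps_nonneg_mult sums_iff fps_mult_nth_scaled)
qed

lemma fps_sums_power: "fps_sums x f c \<Longrightarrow> fps_sums x (f ^ k) (c ^ k)"
  by (induction k) (auto intro: fps_sums_mult fps_sums_1 simp: fps_sums_def[of x f])

lemma fps_sums_sum:
  assumes "finite A" "0 \<le> x" "\<And>i. i \<in> A \<Longrightarrow> fps_sums x (f i) (c i)"
  shows "fps_sums x (sum f A) (sum c A)"
  using assms
proof (induction A rule: finite_induct)
  case empty
  then show ?case using fps_sums_const[of 0 x] by simp
qed (auto intro: fps_sums_add)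

lemma fps_mult_partial_le:
  assumes "fps_nonneg f" "fps_nonneg g" "0 \<le> x"
  shows "(\<Sum>n<N. (f * g) $ n * x ^ n) \<le> (\<Sum>n<N. f $ n * x ^ n) * (\<Sum>n<N. g $ n * x ^ n)"
  using sum_convolution_le[of "\<lambda>n. f $ n * x ^ n" "\<lambda>n. g $ n * x ^ n" N] assms
  by (simp add: fps_nonneg_def fps_mult_nth_scaled)

lemma fps_power_partial_le:
  assumes "fps_nonneg f" "0 \<le> x"
  shows "(\<Sum>n<N. (f ^ k) $ n * x ^ n) \<le> (\<Sum>n<N. f $ n * x ^ n) ^ k"
proof (induction k)
  case 0
  have "(\<Sum>n<N. (1 :: real fps) $ n * x ^ n) \<le> 1"
    using fps_sums_partial[OF fps_sums_1] assms by blast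
  then show ?case by simp
next
  case (Suc k)
  have "(\<Sum>n<N. (f ^ Suc k) $ n * x ^ n) \<le> (\<Sum>n<N. f $ n * x ^ n) * (\<Sum>n<N. (f ^ k) $ n * x ^ n)"
    using fps_mult_partial_le[of f "f ^ k" x N] assms fps_nonneg_power by simp
  also have "\<dots> \<le> (\<Sum>n<N. f $ n * x ^ n) * (\<Sum>n<N. f $ n * x ^ n) ^ k"
    by (intro mult_left_mono Suc sum_nonneg) (use assms in \<open>auto simp: fps_nonneg_def\<close>)
  finally show ?case by simp
qed

text \<open>The partial sums satisfy \<open>S \<le> \<beta> + \<delta> * S\<close>, an a priori
  bound that yields convergence; the equation then determines the value.\<close>

lemma fps_sums_solution:
  assumes f: "f = b + d * f" and b: "fps_sums x b \<beta>" and d: "fps_sums x d \<delta>" "d $ 0 = 0" "\<delta> < 1"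
  shows "fps_sums x f (\<beta> / (1 - \<delta>))"
proof -
  have x: "0 \<le> x" and n: "fps_nonneg f"
    using b d fps_nonneg_solution[OF f] by (auto simp: fps_sums_def)
  have "(\<Sum>n<N. f $ n * x ^ n) \<le> \<beta> / (1 - \<delta>)" for N
  proof -
    let ?S = "\<Sum>n<N. f $ n * x ^ n"
    have S: "0 \<le> ?S" using n x by (auto simp: fps_nonneg_def intro!: sum_nonneg)
    have "?S = (\<Sum>n<N. (b + d * f) $ n * x ^ n)" using f by simp
    also have "\<dots> = (\<Sum>n<N. b $ n * x ^ n) + (\<Sum>n<N. (d * f) $ n * x ^ n)"
      by (simp add: distrib_right sum.distrib)
    also have "(\<Sum>n<N. (d * f) $ n * x ^ n) \<le> (\<Sum>n<N. d $ n * x ^ n) * ?S"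
      using d n x by (intro fps_mult_partial_le) (auto simp: fps_sums_def)
    also have "\<dots> \<le> \<delta> * ?S"
      by (intro mult_right_mono fps_sums_partial d S)
    also have "(\<Sum>n<N. b $ n * x ^ n) \<le> \<beta>" by (rule fps_sums_partial[OF b])
    finally show ?thesis using d(3) by (simp add: field_simps)
  qed
  from fps_sums_of_partial[OF n x this] obtain t where t: "fps_sums x f t" by blast
  have "fps_sums x f (\<beta> + \<delta> * t)"
    using fps_sums_add[OF b fps_sums_mult[OF d(1) t]] f by simp
  then have "t = \<beta> + \<delta> * t" using t fps_sums_unique by blast
  then have "t = \<beta> / (1 - \<delta>)" using d(3) by (simp add: field_simps)
  with t show ?thesis by simp
qed

text \<open>A comparison principle. It reaches \<open>\<delta> = 1\<close>, where
  \<open>fps_sums_solution\<close> does not apply; constant and linear majorants \<open>c\<close>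
  are used below.\<close>

lemma fps_solution_coeff_le:
  assumes f: "f = b + d * f" and d: "fps_sums 1 d \<delta>" "d $ 0 = 0" "fps_nonneg b"
    and c: "mono c" "b $ 0 \<le> c 0" "\<And>n. b $ Suc n + \<delta> * c n \<le> c (Suc n)" "\<And>n. 0 \<le> c n"
  shows "f $ n \<le> c n"
proof (induction n rule: less_induct)
  case (less n)
  have dn: "0 \<le> d $ i" for i using d by (simp add: fps_sums_def fps_nonneg_def)
  have fn: "f $ n = b $ n + (\<Sum>i=0..n. d $ i * f $ (n - i))"
    using f by (metis fps_add_nth fps_mult_nth)
  show ?case
  proof (cases n)
    case 0
    then show ?thesis using fn d c by simp
  next
    case (Suc l)
    have "(\<Sum>i=0..n. d $ i * f $ (n - i)) \<le> (\<Sum>i=0..n. d $ i * c l)"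
    proof (rule sum_mono)
      fix i assume "i \<in> {0..n}"
      show "d $ i * f $ (n - i) \<le> d $ i * c l"
      proof (cases "i = 0")
        case False
        then have "f $ (n - i) \<le> c (n - i)" using less Suc by simp
        also have "\<dots> \<le> c l" using False Suc by (intro monoD[OF c(1)]) simp
        finally show ?thesis using dn by (simp add: mult_left_mono)
      qed (use d in simp)
    qed
    also have "\<dots> = (\<Sum>i<Suc n. d $ i * 1 ^ i) * c l"
      by (simp add: sum_distrib_right atLeast0AtMost lessThan_Suc_atMost)
    also have "\<dots> \<le> \<delta> * c l"
      by (intro mult_right_mono fps_sums_partial d c)
    finally show ?thesis using fn c(3)[of l] Suc by simp
  qed
qed

lemma fps_mult_coeff_le:
  assumes f: "fps_sums 1 f \<phi>" and g: "\<And>n. 0 \<le> g $ n" "\<And>n. g $ n \<le> C"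
  shows "(f * g) $ n \<le> \<phi> * C"
proof -
  have fn: "0 \<le> f $ i" for i using f by (simp add: fps_sums_def fps_nonneg_def)
  have C: "0 \<le> C" using g[of 0] by simp
  have "(f * g) $ n \<le> (\<Sum>i=0..n. f $ i * C)"
    unfolding fps_mult_nth by (intro sum_mono mult_left_mono g fn)
  also have "\<dots> = (\<Sum>i<Suc n. f $ i * 1 ^ i) * C"
    by (simp add: sum_distrib_right atLeast0AtMost lessThan_Suc_atMost)
  also have "\<dots> \<le> \<phi> * C" by (intro mult_right_mono fps_sums_partial f C)
  finally show ?thesis .
qed

section \<open>The branch of \<open>u = X (1 + \<kappa> u^k)\<close> at the origin\<close>

lemma power_diff_le:
  fixes s t :: real
  assumes "0 \<le> s" "s \<le> t"
  shows "t ^ k - s ^ k \<le> real k * t ^ (k - 1) * (t - s)"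
proof (induction k)
  case (Suc k)
  have "t ^ Suc k - s ^ Suc k = t * (t ^ k - s ^ k) + s ^ k * (t - s)" by (simp add: algebra_simps)
  also have "t * (t ^ k - s ^ k) \<le> t * (real k * t ^ (k - 1) * (t - s))"
    using Suc assms by (intro mult_left_mono) auto
  also have "t * (real k * t ^ (k - 1) * (t - s)) = real k * t ^ k * (t - s)"
    by (cases k) auto
  also have "s ^ k * (t - s) \<le> t ^ k * (t - s)"
    using assms by (intro mult_right_mono power_mono) auto
  finally show ?case by (simp add: algebra_simps)
qed simp

text \<open>Induction through the equation keeps the partial sums below \<open>y\<close>, so their
  limit \<open>t\<close> is a fixed point with \<open>t \<le> y\<close>. By \<open>crit\<close> the
  slope of the fixed-point map is below 1 up to \<open>y\<close>, which forces \<open>t = y\<close>: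
  the value lies on the branch of \<open>u\<close>, not on the larger one.\<close>

lemma fps_branch_sums:
  assumes u: "u = fps_X * (1 + fps_const \<kappa> * u ^ k)" and n: "fps_nonneg u"
    and \<kappa>: "0 \<le> \<kappa>" and y: "0 \<le> y" and x: "0 \<le> x" "y = x * (1 + \<kappa> * y ^ k)"
    and crit: "x * \<kappa> * real k * y ^ (k - 1) < 1"
  shows "fps_sums x u y"
proof -
  have u0: "u $ 0 = 0" by (subst u) simp
  have u_Suc: "u $ Suc n = (1 + fps_const \<kappa> * u ^ k) $ n" for n by (subst u) simp
  have p: "(\<Sum>n<N. u $ n * x ^ n) \<le> y" for N
  proof (induction N)
    case (Suc N)
    let ?S = "\<Sum>n<N. u $ n * x ^ n"
    have S: "0 \<le> ?S" using n x by (auto simp: fps_nonneg_def intro!: sum_nonneg)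
    have nn: "0 \<le> (1 + fps_const \<kappa> * u ^ k) $ n" for n
      using u_Suc[of n] n by (metis fps_nonnegD)
    have "(\<Sum>n<Suc N. u $ n * x ^ n) = (\<Sum>n<N. u $ Suc n * x ^ Suc n)"
      by (subst sum.lessThan_Suc_shift) (simp add: u0)
    also have "\<dots> = x * ((\<Sum>n<N. (1 :: real fps) $ n * x ^ n) + \<kappa> * (\<Sum>n<N. (u ^ k) $ n * x ^ n))"
      by (simp add: u_Suc sum_distrib_left sum.distrib[symmetric] algebra_simps)
    also have "\<dots> \<le> x * (1 + \<kappa> * ?S ^ k)"
      using x \<kappa> n by (intro mult_left_mono add_mono fps_power_partial_le fps_sums_partial fps_sums_1) auto
    also have "\<dots> \<le> x * (1 + \<kappa> * y ^ k)"
      using Suc S x \<kappa> by (intro mult_left_mono add_mono power_mono) auto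
    finally show ?case using x by simp
  qed (use y in simp)
  from fps_sums_of_partial[OF n x(1) this] obtain t where t: "fps_sums x u t" "t \<le> y" by blast
  have t0: "0 \<le> t" using fps_sums_ge0 t by blast
  have "fps_sums x u (x * (1 + \<kappa> * t ^ k))"
    by (subst u) (intro fps_sums_mult fps_sums_X fps_sums_add fps_sums_1 fps_sums_const fps_sums_power t x \<kappa>)
  then have tx: "t = x * (1 + \<kappa> * t ^ k)" using fps_sums_unique t by blast
  have "y - t = x * \<kappa> * (y ^ k - t ^ k)" using tx x(2) by (simp add: algebra_simps)
  also have "\<dots> \<le> x * \<kappa> * (real k * y ^ (k - 1) * (y - t))"
    using power_diff_le[OF t0 t(2), of k] x \<kappa> by (intro mult_left_mono) auto
  finally have "(y - t) * (1 - x * \<kappa> * real k * y ^ (k - 1)) \<le> 0" by (simp add: algebra_simps)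
  then have "y \<le> t" using crit by (simp add: mult_le_0_iff)
  with t show ?thesis by simp
qed

text \<open>\<open>u\<close> is the compositional inverse of \<open>X / (1 + \<kappa> X^k)\<close>.
  Nonnegativity follows since coefficient \<open>l + 1\<close> of \<open>u\<close> involves only
  coefficients up to \<open>l\<close>.\<close>

lemma fps_branch_exists:
  fixes \<kappa> :: real
  assumes \<kappa>: "0 \<le> \<kappa>" and k: "0 < k"
  obtains u where "u = fps_X * (1 + fps_const \<kappa> * u ^ k)" "fps_nonneg u"
proof -
  define w :: "real fps" where "w = 1 + fps_const \<kappa> * fps_X ^ k"
  have w0: "w $ 0 = 1" using k by (simp add: w_def)
  define a where "a = fps_X * inverse w"
  have a0: "a $ 0 = 0" and a1: "a $ 1 \<noteq> 0" using w0 by (auto simp: a_def)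
  define u where "u = fps_inv a"
  have u0: "u $ 0 = 0" by (simp add: u_def fps_inv_def)
  have wu: "w oo u = 1 + fps_const \<kappa> * u ^ k"
    using u0 by (simp add: w_def fps_compose_add_distrib fps_compose_mult_distrib fps_compose_power[symmetric])
  have "fps_X = a oo u" using fps_inv_right[OF a0 a1] by (simp add: u_def)
  then have "fps_X * (w oo u) = (a * w) oo u" using u0 by (simp add: fps_compose_mult_distrib)
  also have "a * w = fps_X" using w0 by (simp add: a_def mult.assoc inverse_mult_eq_1)
  finally have u: "u = fps_X * (1 + fps_const \<kappa> * u ^ k)" using u0 wu by simp
  have pow: "0 \<le> (f ^ j) $ m" if "\<And>i. i \<le> m \<Longrightarrow> 0 \<le> f $ i" for f :: "real fps" and j m
    using that
  proof (induction j arbitrary: m)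
    case (Suc j)
    then show ?case by (auto simp: fps_mult_nth intro!: sum_nonneg)
  qed (simp add: fps_one_nth)
  have "0 \<le> u $ n" for n
  proof (induction n rule: less_induct)
    case (less n)
    show ?case
    proof (cases n)
      case (Suc l)
      have "0 \<le> (u ^ k) $ l" by (rule pow) (use less Suc in auto)
      then have "0 \<le> (1 + fps_const \<kappa> * u ^ k) $ l" using \<kappa> by (simp add: fps_one_nth)
      then show ?thesis using Suc by (subst u) simp
    qed (use u0 in simp)
  qed
  then show thesis using u that by (auto simp: fps_nonneg_def)
qed

section \<open>The characteristic polynomial\<close>

lemma power_diff_ge:
  fixes s t :: real
  assumes "0 \<le> s" "s \<le> t"
  shows "real k * s ^ (k - 1) * (t - s) \<le> t ^ k - s ^ k"
proof (induction k)
  case (Suc k)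
  have "real k * s ^ k * (t - s) = s * (real k * s ^ (k - 1) * (t - s))"
    by (cases k) auto
  also have "\<dots> \<le> s * (t ^ k - s ^ k)"
    using Suc assms by (intro mult_left_mono) auto
  finally have 1: "real k * s ^ k * (t - s) \<le> s * (t ^ k - s ^ k)" .
  have "s ^ k * (t - s) \<le> t ^ k * (t - s)"
    using assms by (intro mult_right_mono power_mono) auto
  moreover have "t ^ Suc k - s ^ Suc k = s * (t ^ k - s ^ k) + t ^ k * (t - s)" by (simp add: algebra_simps)
  ultimately show ?case using 1 by (simp add: algebra_simps)
qed simp

text \<open>The induction step adds \<open>1 - s\<close> times a polynomial whose own increments are
  nonnegative multiples of \<open>(1 - s)^2\<close>. The lemma serves
  \<open>tc_fixed\<close>.\<close>

lemma power_comparison: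
  fixes s :: real
  assumes s: "0 \<le> s" "s \<le> 1"
  shows "(real n + 2) * (s - s ^ (n + 1)) \<le> real n * (1 - s ^ (n + 2))"
proof (induction n)
  case (Suc n)
  have q: "0 \<le> 1 - (real m + 1) * s ^ m + real m * s ^ (m + 1)" for m
  proof (induction m)
    case (Suc m)
    have "1 - (real (Suc m) + 1) * s ^ Suc m + real (Suc m) * s ^ (Suc m + 1) =
      (1 - (real m + 1) * s ^ m + real m * s ^ (m + 1)) + (real m + 1) * s ^ m * (1 - s)\<^sup>2"
      by (simp add: algebra_simps power2_eq_square)
    also have "0 \<le> \<dots>" by (rule add_nonneg_nonneg[OF Suc]) (use s in simp)
    finally show ?case .
  qed simp
  have "real (Suc n) * (1 - s ^ (Suc n + 2)) - (real (Suc n) + 2) * (s - s ^ (Suc n + 1)) =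
      (real n * (1 - s ^ (n + 2)) - (real n + 2) * (s - s ^ (n + 1))) +
      (1 - s) * (1 - (real (Suc n) + 1) * s ^ Suc n + real (Suc n) * s ^ (Suc n + 1))"
    by (simp add: algebra_simps)
  moreover have "0 \<le> (1 - s) * (1 - (real (Suc n) + 1) * s ^ Suc n + real (Suc n) * s ^ (Suc n + 1))"
    using q[of "Suc n"] s by (intro mult_nonneg_nonneg) auto
  ultimately show ?case using Suc by linarith
qed simp

locale fib =
  fixes p q \<Lambda> \<kappa> :: real and k :: nat
  assumes p01: "0 \<le> p" "p \<le> 1" and q_eq: "q = 1 - p" and k3: "3 \<le> k"
    and lam_eq: "\<Lambda> = fib_lambda k" and kap_eq: "\<kappa> = p * q ^ (k - 1)"
begin

lemma q0: "0 \<le> q" using p01 q_eq by simp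

lemma kap0: "0 \<le> \<kappa>" using p01 q0 kap_eq by simp

lemma q_pow_Suc: "q ^ (k - 1) * q = q ^ k"
  using k3 by (cases k) auto

lemma angle: "0 < pi / k" "pi / k \<le> pi / 3" "pi / k < pi"
  using k3 by (auto simp: field_simps)

lemma sin_pos: "0 < sin (pi / k)"
  using angle by (intro sin_gt_zero) auto

lemma lam_ge1: "1 \<le> \<Lambda>"
  using cos_monotone_0_pi_le[of "pi / k" "pi / 3"] angle by (simp add: lam_eq fib_lambda_def cos_60)

lemma lam_lt2: "\<Lambda> < 2"
  using cos_monotone_0_pi[of 0 "pi / k"] angle by (simp add: lam_eq fib_lambda_def)

text \<open>From \<open>cos x = 1 - 2 sin(x/2)^2\<close> and \<open>sin y \<le> y\<close>; what
  remains is \<open>pi^2 < 4 k\<close>, and \<open>3.2^2 = 10.24\<close> is below 12. The bound is a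
  quantitative input on both sides of the critical value.\<close>

lemma lam_gt: "2 - 4 / k < \<Lambda>"
proof -
  let ?y = "pi / k / 2"
  have "cos (pi / k) = 1 - 2 * (sin ?y)\<^sup>2" using cos_double_sin[of ?y] by simp
  moreover have "(sin ?y)\<^sup>2 \<le> ?y\<^sup>2"
    using sin_x_le_x[of ?y] angle by (intro power_mono sin_ge_zero) auto
  moreover have "?y\<^sup>2 < 1 / k"
  proof -
    have "pi\<^sup>2 < 3.2\<^sup>2" using pi_approx by (intro power_strict_mono) auto
    also have "\<dots> < 4 * real k" using k3 by (simp add: power2_eq_square)
    finally show ?thesis using k3 by (simp add: power2_eq_square field_simps)
  qed
  ultimately show ?thesis by (simp add: lam_eq fib_lambda_def)
qed

section \<open>Chebyshev values of the second kind at \<open>cos (pi / k)\<close> and their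
  truncated sums\<close>

definition U :: "nat \<Rightarrow> real" where "U j = sin (j * (pi / k)) / sin (pi / k)"

lemma U_0: "U 0 = 0" by (simp add: U_def)

lemma U_1: "U (Suc 0) = 1" using sin_pos by (simp add: U_def)

lemma U_rec: "U (Suc (Suc j)) = \<Lambda> * U (Suc j) - U j"
proof -
  let ?x = "pi / k"
  have "sin (real (Suc j) * ?x + ?x) + sin (real (Suc j) * ?x - ?x) = 2 * cos ?x * sin (real (Suc j) * ?x)"
    by (simp add: sin_add sin_diff)
  moreover have "real (Suc j) * ?x + ?x = real (Suc (Suc j)) * ?x" "real (Suc j) * ?x - ?x = real j * ?x"
    by (simp_all add: algebra_simps add_divide_distrib)
  ultimately show ?thesis
    using sin_pos by (simp add: U_def lam_eq fib_lambda_def field_simps)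
qed

lemma U_nonneg: "j \<le> k \<Longrightarrow> 0 \<le> U j"
proof -
  assume "j \<le> k"
  then have "real j * (pi / k) \<le> pi" using k3 by (simp add: field_simps)
  then show ?thesis unfolding U_def using sin_pos angle
    by (intro divide_nonneg_pos sin_ge_zero) auto
qed

lemma U_k: "U k = 0" using k3 by (simp add: U_def)

lemma U_k1: "U (k - 1) = 1"
proof -
  have "real (k - 1) * (pi / k) = pi - pi / k" using k3 by (simp add: field_simps)
  then show ?thesis using sin_pos by (simp add: U_def)
qed

lemma U_k2: "U (k - 2) = \<Lambda>"
proof -
  have "Suc (k - 2) = k - 1" "Suc (k - 1) = k" using k3 by auto
  then show ?thesis using U_rec[of "k - 2"] U_k U_k1 by simp
qed

text \<open>Collects the entries of the blocks \<open>+ -^j\<close>; \<open>j\<close> stops at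
  \<open>k - 2\<close>, since with one more \<open>-\<close> the block cancels.\<close>

definition sg :: "nat \<Rightarrow> real \<Rightarrow> real" where
  "sg i t = (\<Sum>j<k - 1. q ^ j * U (j + i) * t ^ j)"

lemma sg_nonneg: "i \<le> 2 \<Longrightarrow> 0 \<le> t \<Longrightarrow> 0 \<le> sg i t"
  unfolding sg_def using q0 by (intro sum_nonneg mult_nonneg_nonneg U_nonneg) auto

lemma sg_mono: "i \<le> 2 \<Longrightarrow> 0 \<le> s \<Longrightarrow> s \<le> t \<Longrightarrow> sg i s \<le> sg i t"
  unfolding sg_def using q0
  by (intro sum_mono mult_left_mono mult_nonneg_nonneg U_nonneg power_mono) auto

lemma sg_1_ge1: "0 \<le> t \<Longrightarrow> 1 \<le> sg 1 t"
proof -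
  assume t: "0 \<le> t"
  have "(\<lambda>j. q ^ j * U (j + 1) * t ^ j) 0 \<le> sg 1 t"
    unfolding sg_def using q0 t k3
    by (intro member_le_sum mult_nonneg_nonneg U_nonneg) auto
  then show ?thesis using U_1 by simp
qed

lemma sg_2: "sg 2 t = \<Lambda> * sg 1 t - sg 0 t"
  unfolding sg_def sum_distrib_left sum_subtractf[symmetric]
  by (intro sum.cong) (auto simp: U_rec algebra_simps)

lemma sg_0: "sg 0 t = q * t * sg 1 t - (q * t) ^ (k - 1)"
proof -
  have "sg 0 t + (q * t) ^ (k - 1) = (\<Sum>j<Suc (k - 1). q ^ j * U j * t ^ j)"
    using U_k1 by (simp add: sg_def power_mult_distrib)
  also have "\<dots> = q * t * sg 1 t"
    by (subst sum.lessThan_Suc_shift) (simp add: U_0 sg_def sum_distrib_left algebra_simps)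
  finally show ?thesis by simp
qed

text \<open>The recurrence of \<open>U\<close> makes multiplication by
  \<open>1 - \<Lambda> s + s^2\<close> telescope; the boundary values are \<open>U k = 0\<close> and
  \<open>U (k - 1) = 1\<close>.\<close>

lemma sg_1: "(1 - \<Lambda> * (q * t) + (q * t)\<^sup>2) * sg 1 t = 1 + (q * t) ^ k"
proof -
  have "(1 - \<Lambda> * s + s\<^sup>2) * (\<Sum>j<n. s ^ j * U (Suc j)) = 1 - s ^ n * U (Suc n) + s ^ Suc n * U n" for s n
    by (induction n) (simp_all add: U_0 U_1 U_rec algebra_simps power2_eq_square)
  from this[of "q * t" "k - 1"] show ?thesis
    using U_k U_k1 k3 by (simp add: sg_def power_mult_distrib mult_ac)
qed

text \<open>Determinant of the identity minus \<open>p t\<close> times the symmetric matrix with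
  entries \<open>sg 0\<close>, \<open>sg 1\<close>, \<open>sg 2\<close>.\<close>

definition det :: "real \<Rightarrow> real" where
  "det t = (1 - p * t * sg 0 t) * (1 - p * t * sg 2 t) - (p * t * sg 1 t)\<^sup>2"

text \<open>The reciprocal polynomial of \<open>fib_poly k p\<close>, in the variable
  \<open>t = 1 / X\<close> that is a value of the series \<open>u\<close>.\<close>

definition D :: "real \<Rightarrow> real" where
  "D t = 1 - \<Lambda> * t - (2 * p - 1) * t\<^sup>2 - \<Lambda> * \<kappa> * t ^ (k + 1) - \<kappa>\<^sup>2 * t ^ (2 * k)"

lemma quadratic_pos: "0 < x \<or> 0 < y \<Longrightarrow> 0 \<le> x \<Longrightarrow> 0 \<le> y \<Longrightarrow> 0 < x\<^sup>2 - \<Lambda> * x * y + y\<^sup>2"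
proof -
  assume a: "0 < x \<or> 0 < y" "0 \<le> x" "0 \<le> y"
  have "x\<^sup>2 - \<Lambda> * x * y + y\<^sup>2 = (1 - \<Lambda> / 2) * (x\<^sup>2 + y\<^sup>2) + \<Lambda> / 2 * (x - y)\<^sup>2"
    by (simp add: power2_eq_square field_simps)
  also have "\<dots> > 0"
  proof (rule add_pos_nonneg)
    have "0 < x\<^sup>2 + y\<^sup>2" using a by (auto simp: sum_power2_gt_zero_iff)
    then show "0 < (1 - \<Lambda> / 2) * (x\<^sup>2 + y\<^sup>2)" using lam_lt2 by simp
    show "0 \<le> \<Lambda> / 2 * (x - y)\<^sup>2" using lam_ge1 by simp
  qed
  finally show ?thesis .
qed

lemma det_D: "(1 - \<Lambda> * (q * t) + (q * t)\<^sup>2) * det t = D t"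
proof -
  \<comment> \<open>\<open>s\<close>, \<open>R\<close> and \<open>S\<close> hide powers and sums,
    leaving a polynomial identity modulo \<open>W\<close> and \<open>s = (1 - p) t\<close>.\<close>
  define s where "s = q * t"
  define R where "R = s ^ (k - 1)"
  define S where "S = sg 1 t"
  have sk: "s ^ k = s * R" using k3 by (cases k) (auto simp: R_def)
  have kt: "\<kappa> * t ^ k = p * t * R"
  proof -
    have "t ^ k = t * t ^ (k - 1)" using k3 by (cases k) auto
    then show ?thesis by (simp add: kap_eq R_def s_def power_mult_distrib)
  qed
  have "D t = 1 - \<Lambda> * t - (2 * p - 1) * t\<^sup>2 - \<Lambda> * t * (\<kappa> * t ^ k) - (\<kappa> * t ^ k)\<^sup>2"
    by (simp add: D_def power_mult_distrib power_mult[symmetric] mult.commute)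
  then have DD: "D t = 1 - \<Lambda> * t - (2 * p - 1) * t\<^sup>2 - \<Lambda> * t * (p * t * R) - (p * t * R)\<^sup>2"
    by (simp only: kt)
  have W: "(1 - \<Lambda> * s + s\<^sup>2) * S = 1 + s * R"
    using sg_1[of t] sk by (simp add: s_def S_def)
  have s: "s = (1 - p) * t" by (simp add: s_def q_eq)
  have "det t = (1 - p * t * (s * S - R)) * (1 - p * t * (\<Lambda> * S - (s * S - R))) - (p * t * S)\<^sup>2"
    unfolding det_def sg_2 sg_0 by (simp add: s_def S_def R_def)
  also have "(1 - \<Lambda> * s + s\<^sup>2) * \<dots> = D t"
    unfolding DD using W s by algebra
  finally show ?thesis by (simp add: s_def)
qed

lemma W_pos: "0 \<le> t \<Longrightarrow> 0 < 1 - \<Lambda> * (q * t) + (q * t)\<^sup>2"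
  using quadratic_pos[of 1 "q * t"] q0 by simp

lemma det_zero_iff: "0 \<le> t \<Longrightarrow> det t = 0 \<longleftrightarrow> D t = 0"
  using W_pos[of t] det_D[of t] by auto

text \<open>The matrix with entries \<open>sg 0\<close>, \<open>sg 1\<close>, \<open>sg 2\<close> has negative determinant, so only its positive
  eigenvalue can reach the critical value.\<close>

lemma root_factors_pos:
  assumes t: "0 < t" and p: "0 < p" and D: "D t = 0"
  shows "p * t * sg 0 t < 1" "p * t * sg 2 t < 1"
proof -
  let ?A = "p * t * sg 0 t" and ?B = "p * t * sg 1 t" and ?C = "p * t * sg 2 t"
  have B: "0 < ?B" using t p sg_1_ge1[of t] by (auto intro!: mult_pos_pos)
  have eq: "(1 - ?A) * (1 - ?C) = ?B\<^sup>2"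
    using det_zero_iff[of t] t D by (simp add: det_def)
  have "?A * ?C < ?B\<^sup>2"
  proof -
    have "0 < (sg 0 t)\<^sup>2 - \<Lambda> * sg 0 t * sg 1 t + (sg 1 t)\<^sup>2"
      using sg_nonneg[of _ t] sg_1_ge1[of t] t by (intro quadratic_pos) auto
    then have "sg 0 t * sg 2 t < (sg 1 t)\<^sup>2" unfolding sg_2 by (simp add: power2_eq_square algebra_simps)
    then have "(p * t)\<^sup>2 * (sg 0 t * sg 2 t) < (p * t)\<^sup>2 * (sg 1 t)\<^sup>2"
      using p t by (intro mult_strict_left_mono) auto
    then show ?thesis by (simp add: power2_eq_square mult_ac)
  qed
  moreover have "0 \<le> ?A" "0 \<le> ?C" using p t sg_nonneg[of _ t] by auto
  moreover have "0 < (1 - ?A) * (1 - ?C)" unfolding eq using B by (rule zero_less_power)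
  \<comment> \<open>With \<open>?A * ?C < ?B^2\<close> the equation gives
    \<open>?A + ?C < 1\<close>, which excludes two negative factors.\<close>
  ultimately have "\<not> (1 - ?A < 0 \<and> 1 - ?C < 0)"
    using eq by (auto simp: algebra_simps)
  with \<open>0 < (1 - ?A) * (1 - ?C)\<close> have "0 < 1 - ?A \<and> 0 < 1 - ?C"
    by (auto simp: zero_less_mult_iff)
  then show "?A < 1" "?C < 1" by auto
qed

text \<open>At a positive root both factors of the product in \<open>det\<close> are positive. From
  one root to a larger one their product cannot increase, while \<open>(p t sg 1 t)^2\<close>
  strictly increases, so the two cannot be equal at both.\<close>

lemma D_root_unique:
  assumes p: "0 < p" and s: "0 < s" "D s = 0" and t: "0 < t" "D t = 0"
  shows "s = t"
proof -
  have False if "0 < s" "s < t" "D s = 0" "D t = 0" for s t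
  proof -
    have le: "p * s * sg i s \<le> p * t * sg i t" if "i \<le> 2" for i
      using \<open>0 < s\<close> \<open>s < t\<close> p that by (intro mult_mono sg_mono mult_nonneg_nonneg sg_nonneg) auto
    have "p * s * sg 1 s \<le> p * s * sg 1 t"
      using \<open>0 < s\<close> \<open>s < t\<close> p by (intro mult_left_mono sg_mono) auto
    also have "\<dots> < p * t * sg 1 t"
      using \<open>0 < s\<close> \<open>s < t\<close> p sg_1_ge1[of t] by (intro mult_strict_right_mono) auto
    finally have "(p * s * sg 1 s)\<^sup>2 < (p * t * sg 1 t)\<^sup>2"
      using \<open>0 < s\<close> p sg_nonneg[of 1 s] by (intro power_strict_mono) auto
    moreover have "(1 - p * t * sg 0 t) * (1 - p * t * sg 2 t) \<le> (1 - p * s * sg 0 s) * (1 - p * s * sg 2 s)"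
      using le[of 0] le[of 2] root_factors_pos[of t] root_factors_pos[of s] that p
      by (intro mult_mono) auto
    moreover have "(1 - p * t * sg 0 t) * (1 - p * t * sg 2 t) = (p * t * sg 1 t)\<^sup>2"
      "(1 - p * s * sg 0 s) * (1 - p * s * sg 2 s) = (p * s * sg 1 s)\<^sup>2"
      using det_zero_iff[of t] det_zero_iff[of s] that by (auto simp: det_def)
    ultimately show False by simp
  qed
  then show ?thesis using s t by (metis linorder_neqE_linordered_idom)
qed

lemma fib_poly_D:
  assumes "0 < t"
  shows "poly (fib_poly k p) (1 / t) * t ^ (2 * k) = D t"
proof -
  have c: "(1 / t) ^ a * t ^ (2 * k) = t ^ (2 * k - a)" if "a \<le> 2 * k" for a
    using assms that by (simp add: power_one_over power_diff)
  have "2 * k - (2 * k - 1) = 1" "2 * k - (2 * k - 2) = 2" "2 * k - (k - 1) = k + 1" using k3 by auto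
  then have e: "(1 / t) ^ (2 * k - 1) * t ^ (2 * k) = t" "(1 / t) ^ (2 * k - 2) * t ^ (2 * k) = t\<^sup>2"
    "(1 / t) ^ (k - 1) * t ^ (2 * k) = t ^ (k + 1)" "(1 / t) ^ (2 * k) * t ^ (2 * k) = 1"
    using c[of "2 * k - 1"] c[of "2 * k - 2"] c[of "k - 1"] c[of "2 * k"] by auto
  have "poly (fib_poly k p) (1 / t) * t ^ (2 * k) =
    (1 / t) ^ (2 * k) * t ^ (2 * k) - \<Lambda> * ((1 / t) ^ (2 * k - 1) * t ^ (2 * k))
     - (2 * p - 1) * ((1 / t) ^ (2 * k - 2) * t ^ (2 * k)) - \<Lambda> * p * q ^ (k - 1) * ((1 / t) ^ (k - 1) * t ^ (2 * k))
     - p\<^sup>2 * q ^ (2 * k - 2) * t ^ (2 * k)"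
    by (simp add: fib_poly_def poly_monom lam_eq q_eq left_diff_distrib mult.assoc)
  also have "\<dots> = D t"
  proof -
    have "2 * k - 2 = (k - 1) * 2" by simp
    then have "q ^ (2 * k - 2) = (q ^ (k - 1))\<^sup>2" by (simp only: power_mult)
    then show ?thesis unfolding e D_def by (simp add: kap_eq power_mult_distrib)
  qed
  finally show ?thesis .
qed

lemma pos_roots:
  assumes p: "0 < p" and t: "0 < t" "D t = 0"
  shows "{x. 0 < x \<and> poly (fib_poly k p) x = 0} = {1 / t}"
proof -
  have "poly (fib_poly k p) (1 / s) = 0 \<longleftrightarrow> D s = 0" if "0 < s" for s
    using fib_poly_D[OF that] that by auto
  note root_iff = this
  show ?thesis
  proof (intro set_eqI iffI)
    fix x assume "x \<in> {x. 0 < x \<and> poly (fib_poly k p) x = 0}"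
    then have "0 < 1 / x" "D (1 / x) = 0" using root_iff[of "1 / x"] by auto
    then show "x \<in> {1 / t}" using D_root_unique[OF p t, of "1 / x"] by auto
  qed (use root_iff[OF t(1)] t in auto)
qed

text \<open>\<open>tc\<close> is the point where the bound \<open>1 + \<kappa> t^k > t\<close> forces \<open>D t < 0\<close>: on the curve
  \<open>\<kappa> t^k = t - 1\<close> one has \<open>D t = t (2 - (\<Lambda> + 2 p) t)\<close>.\<close>

definition tc :: real where "tc = 2 / (\<Lambda> + 2 * p)"

lemma tc_pos: "0 < tc" using lam_ge1 p01 by (simp add: tc_def)

text \<open>These facts make \<open>tc\<close> the right end of the search for the root:
  \<open>tc_fixed\<close> and \<open>tc_deriv\<close> keep the branch of \<open>u\<close> valid with
  \<open>z < 1\<close>, \<open>q_tc\<close> makes the geometric series in \<open>r\<close> converge,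
  and \<open>D_tc\<close> gives the sign change.\<close>

lemma supercritical:
  assumes pc: "fib_crit k < p"
  shows tc_fixed: "tc < 1 + \<kappa> * tc ^ k" and q_tc: "q * tc < 1"
    and tc_deriv: "\<kappa> * real k * tc ^ (k - 1) < 1" and D_tc: "D tc < 0"
proof -
  have lp: "0 < \<Lambda> + 2 * p" using lam_ge1 p01 by simp
  have pc': "2 < \<Lambda> + 4 * p" using pc by (simp add: fib_crit_def lam_eq field_simps)
  show qt: "q * tc < 1" using pc' lp by (simp add: tc_def q_eq field_simps)
  define s where "s = q * tc"
  have s: "0 \<le> s" "s < 1" using q0 tc_pos qt by (auto simp: s_def)
  show fixed: "tc < 1 + \<kappa> * tc ^ k"
  proof (cases "q = 0")
    case True
    then have "tc < 1" unfolding tc_def using lam_ge1 q_eq by simp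
    then show ?thesis using kap0 tc_pos by (smt (verit) mult_nonneg_nonneg zero_le_power)
  next
    case False
    then have q: "0 < q" using q0 by simp
    then have s0: "0 < s" using tc_pos by (simp add: s_def)
    obtain n where n: "k = n + 2" using that[of "k - 2"] k3 by simp
    have sk: "s ^ k < 1" using s k3 by (simp add: power_less_one_iff)
    \<comment> \<open>The goal, multiplied by \<open>q\<close> and then by \<open>2 + 2 * s\<close>,
      reduces to \<open>s\<close> times the inequality \<open>key\<close>, which is proved
      first.\<close>
    have "2 * (real k * (s - s ^ (k - 1))) \<le> 2 * ((real k - 2) * (1 - s ^ k))"
      using power_comparison[of s n] s n by (simp add: add.commute)
    also have "\<dots> < real k * \<Lambda> * (1 - s ^ k)"
    proof -
      have "2 * (real k - 2) < real k * \<Lambda>" using lam_gt k3 by (simp add: field_simps)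
      then have "(2 * (real k - 2)) * (1 - s ^ k) < (real k * \<Lambda>) * (1 - s ^ k)"
        using sk by (intro mult_strict_right_mono) auto
      then show ?thesis by (simp add: algebra_simps)
    qed
    finally have "real k * (2 * (s - s ^ (k - 1))) < real k * (\<Lambda> * (1 - s ^ k))" by (simp add: mult_ac)
    then have key: "2 * (s - s ^ (k - 1)) < \<Lambda> * (1 - s ^ k)" using k3 by simp
    have sp: "s * (\<Lambda> + 2 * p) = 2 * (1 - p)" using lp by (simp add: s_def tc_def q_eq)
    then have p_s: "p * (2 + 2 * s) = 2 - \<Lambda> * s" and q_s: "q * (2 + 2 * s) = s * (\<Lambda> + 2)"
      by (auto simp: q_eq algebra_simps)
    have ss: "s ^ k = s * s ^ (k - 1)" using k3 by (cases k) auto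
    have "(q - s + p * s ^ k) * (2 + 2 * s) = q * (2 + 2 * s) - s * (2 + 2 * s) + p * (2 + 2 * s) * s ^ k"
      by (simp add: algebra_simps)
    also have "\<dots> = s * (\<Lambda> * (1 - s ^ k) - 2 * (s - s ^ (k - 1)))"
      unfolding p_s q_s ss by (simp add: algebra_simps)
    also have "\<dots> > 0" using key s0 by simp
    finally have "0 < q - s + p * s ^ k" using s by (simp add: zero_less_mult_iff)
    moreover have "q * (\<kappa> * tc ^ k) = p * s ^ k"
      using q_pow_Suc by (simp add: kap_eq s_def power_mult_distrib mult.commute[of q])
    ultimately have "q * tc < q * (1 + \<kappa> * tc ^ k)" by (simp add: s_def distrib_left)
    then show ?thesis using q by simp
  qed
  show "\<kappa> * real k * tc ^ (k - 1) < 1"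
  proof (cases "q = 0")
    case True
    then have "\<kappa> = 0" using k3 by (simp add: kap_eq power_0_left)
    then show ?thesis by simp
  next
    case False
    then have q: "0 < q" using q0 by simp
    \<comment> \<open>\<open>1 / q\<close> is a fixed point of \<open>1 + \<kappa> y^k\<close> to
      the right of \<open>tc\<close>. By convexity the slope at \<open>tc\<close> is at most the
      secant slope to it, which is below 1 by \<open>fixed\<close>.\<close>
    define y where "y = 1 / q"
    have y: "tc < y" using qt q by (simp add: y_def field_simps)
    have "q * (\<kappa> * y ^ k) = p * (q ^ (k - 1) * q * y ^ k)" by (simp add: kap_eq)
    also have "\<dots> = p" unfolding q_pow_Suc using q by (simp add: y_def power_one_over)
    finally have "q * (\<kappa> * y ^ k) = p" .
    then have fy: "\<kappa> * y ^ k = y - 1" using q by (simp add: y_def q_eq field_simps)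
    have "\<kappa> * (real k * tc ^ (k - 1) * (y - tc)) \<le> \<kappa> * (y ^ k - tc ^ k)"
      using power_diff_ge[of tc y k] tc_pos y kap0 by (intro mult_left_mono) auto
    also have "\<dots> < 1 * (y - tc)" using fy fixed by (simp add: right_diff_distrib)
    finally have "(\<kappa> * real k * tc ^ (k - 1)) * (y - tc) < 1 * (y - tc)" by (simp add: mult_ac)
    then show ?thesis using y by (simp only: mult_less_cancel_right)
  qed
  \<comment> \<open>Substituting \<open>2 p tc = 2 - \<Lambda> tc\<close> makes \<open>D tc\<close>
    factor; \<open>1 + y - tc\<close> is positive by \<open>fixed\<close>, the other factor is
    negative.\<close>
  define y where "y = \<kappa> * tc ^ k"
  have y0: "0 \<le> y" using kap0 tc_pos by (simp add: y_def)
  have pt: "2 * p * tc = 2 - \<Lambda> * tc" using lp by (simp add: tc_def field_simps)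
  have "tc ^ (2 * k) = tc ^ k * tc ^ k" by (simp add: mult_2 power_add)
  then have "D tc = 1 - \<Lambda> * tc - (2 * p * tc - tc) * tc - \<Lambda> * tc * y - y\<^sup>2"
    by (simp add: D_def y_def power2_eq_square algebra_simps)
  also have "\<dots> = (1 + y - tc) * (1 - y - (1 + \<Lambda>) * tc)"
    unfolding pt by (simp add: power2_eq_square algebra_simps)
  also have "\<dots> < 0"
  proof -
    have "1 < (1 + \<Lambda>) * tc" using lam_ge1 p01 lp by (simp add: tc_def field_simps)
    then show ?thesis using fixed y0 by (intro mult_pos_neg) (auto simp: y_def)
  qed
  finally show "D tc < 0" .
qed

lemma D_root_exists:
  assumes "fib_crit k < p"
  obtains t where "0 < t" "t < tc" "D t = 0"
proof -
  have D0: "D 0 = 1" using k3 by (simp add: D_def)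
  have "continuous_on {0..tc} D" unfolding D_def[abs_def] by (intro continuous_intros)
  then have "\<exists>t\<ge>0. t \<le> tc \<and> D t = 0"
    using tc_pos D_tc[OF assms] D0 by (intro IVT2') auto
  then obtain t where t: "0 \<le> t" "t \<le> tc" "D t = 0" by auto
  with D0 show thesis using that[of t] D_tc[OF assms] by (cases "t = 0"; cases "t = tc") auto
qed

end

section \<open>Generating function of the expectations\<close>

lemma fps_compose_Abs_fps:
  fixes r :: "real fps"
  assumes "r $ 0 = 0"
  shows "Abs_fps s oo r = fps_const (s 0) + r * (Abs_fps (\<lambda>j. s (Suc j)) oo r)"
proof -
  have "Abs_fps s = fps_const (s 0) + fps_X * Abs_fps (\<lambda>j. s (Suc j))"
    by (rule fps_ext) simp
  then have "Abs_fps s oo r = (fps_const (s 0) + fps_X * Abs_fps (\<lambda>j. s (Suc j))) oo r" by simp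
  then show ?thesis
    using assms by (simp add: fps_compose_add_distrib fps_compose_mult_distrib)
qed

lemma fps_compose_le:
  assumes r: "fps_nonneg r" and s: "\<And>j. 0 \<le> s j" "\<And>j. s j \<le> C"
  shows "0 \<le> (Abs_fps s oo r) $ n" "(Abs_fps s oo r) $ n \<le> C * (Abs_fps (\<lambda>_. 1) oo r) $ n"
  using fps_nonnegD[OF fps_nonneg_power[OF r]] s
  by (auto simp: fps_compose_nth sum_distrib_left intro!: sum_nonneg sum_mono mult_right_mono)

context fib
begin

text \<open>The primitive excursions \<open>+ \<dots> -\<close> that reduce to the empty word have generating function
  \<open>1 - 1 / w\<close>, where \<open>u = X w\<close>; \<open>r = q u\<close> is the first-passage series for going one \<open>-\<close> further down.\<close>

definition u :: "real fps" where
  "u = (SOME u. u = fps_X * (1 + fps_const \<kappa> * u ^ k) \<and> fps_nonneg u)"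

lemma u: "u = fps_X * (1 + fps_const \<kappa> * u ^ k)" and u_nonneg: "fps_nonneg u"
proof -
  have "\<exists>u. u = fps_X * (1 + fps_const \<kappa> * u ^ k) \<and> fps_nonneg u"
    using fps_branch_exists[OF kap0, of k] k3 by (metis (full_types) less_le_trans zero_less_numeral)
  from someI_ex[OF this]
  show "u = fps_X * (1 + fps_const \<kappa> * u ^ k)" "fps_nonneg u" unfolding u_def by auto
qed

lemma u_0: "u $ 0 = 0" by (subst u) simp

definition w :: "real fps" where "w = 1 + fps_const \<kappa> * u ^ k"

lemma u_w: "u = fps_X * w" unfolding w_def by (rule u)

lemma w_0: "w $ 0 = 1" using u_0 k3 by (simp add: w_def)

lemma u_1: "u $ 1 = 1" using w_0 by (subst u_w) simp

definition r :: "real fps" where "r = fps_const q * u"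

text \<open>A block \<open>+ -^j\<close> acts on \<open>(x, y)\<close> by a symmetric Hankel-type matrix with entries \<open>U j\<close>,
  \<open>U (j + 1)\<close>, \<open>U (j + 2)\<close>, so the row vector \<open>(L1, L2)\<close> of expectations over words without an initial
  \<open>-\<close> solves \<open>L1 = p u (s0 L1 + s1 L2)\<close> and \<open>L2 = w + p u (s1 L1 + s2 L2)\<close> with \<open>si = fsg i\<close>.
  Eliminating \<open>L1 = a L2\<close> leaves the scalar equation \<open>L2 = w + d L2\<close>.\<close>

definition fsg :: "nat \<Rightarrow> real fps" where
  "fsg i = (\<Sum>j<k - 1. fps_const (q ^ j * U (j + i)) * u ^ j)"

definition pu :: "real fps" where "pu = fps_const p * u"

definition a :: "real fps" where "a = pu * fsg 1 * inverse (1 - pu * fsg 0)"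

definition d :: "real fps" where "d = pu * fsg 2 + pu * fsg 1 * a"

lemma r_0: "r $ 0 = 0" and pu_0: "pu $ 0 = 0" by (simp_all add: r_def pu_def u_0)

lemma d_0: "d $ 0 = 0" by (simp add: d_def pu_0)

lemma a_eq: "a = pu * fsg 1 + pu * fsg 0 * a"
proof -
  have "inverse (1 - pu * fsg 0) * (1 - pu * fsg 0) = 1"
    by (rule inverse_mult_eq_1) (simp add: pu_0)
  then show ?thesis unfolding a_def by algebra
qed

lemma r_nonneg: "fps_nonneg r" and pu_nonneg: "fps_nonneg pu" and w_nonneg: "fps_nonneg w"
  unfolding r_def pu_def w_def using fps_nonneg_const[of 1]
  by (auto intro!: fps_nonneg_mult fps_nonneg_add fps_nonneg_power fps_nonneg_const u_nonneg q0 p01 kap0)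

lemma fsg_nonneg: "i \<le> 2 \<Longrightarrow> fps_nonneg (fsg i)"
  unfolding fsg_def
  by (intro fps_nonneg_sum fps_nonneg_mult fps_nonneg_power fps_nonneg_const u_nonneg
      mult_nonneg_nonneg zero_le_power q0 U_nonneg) auto

lemma a_nonneg: "fps_nonneg a"
  by (rule fps_nonneg_solution[OF a_eq]) (auto simp: pu_0 intro!: fps_nonneg_mult pu_nonneg fsg_nonneg)

lemma d_nonneg: "fps_nonneg d"
  unfolding d_def by (intro fps_nonneg_add fps_nonneg_mult pu_nonneg fsg_nonneg a_nonneg) auto

text \<open>Supplies aperiodicity for \<open>renewal\<close>: the one-toss block \<open>+\<close>
  alone contributes \<open>p * \<Lambda>\<close>.\<close>

lemma d_1_pos: assumes "0 < p" shows "0 < d $ 1"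
proof -
  have "fsg 2 $ 0 = (\<Sum>j<k - 1. if j = 0 then \<Lambda> else 0)"
    unfolding fsg_def fps_sum_nth
  proof (rule sum.cong[OF refl])
    fix j
    show "(fps_const (q ^ j * U (j + 2)) * u ^ j) $ 0 = (if j = 0 then \<Lambda> else 0)"
      using U_rec[of 0] by (cases j) (auto simp: u_0 U_0 U_1 numeral_2_eq_2)
  qed
  then have "fsg 2 $ 0 = \<Lambda>" using k3 by simp
  then have "(pu * fsg 2) $ 1 = p * \<Lambda>"
    using u_1 by (simp add: fps_mult_nth pu_0) (simp add: pu_def)
  moreover have "0 \<le> (pu * fsg 1 * a) $ 1"
    by (intro fps_nonnegD fps_nonneg_mult pu_nonneg fsg_nonneg a_nonneg) auto
  moreover have "0 < p * \<Lambda>" using assms lam_ge1 by simp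
  ultimately show ?thesis by (simp add: d_def)
qed

lemma sums_lemmas:
  assumes "fps_sums x u y"
  shows w_sums: "fps_sums x w (1 + \<kappa> * y ^ k)"
    and r_sums: "fps_sums x r (q * y)"
    and fsg_sums: "i \<le> 2 \<Longrightarrow> fps_sums x (pu * fsg i) (p * y * sg i y)"
proof -
  have x: "0 \<le> x" using assms by (simp add: fps_sums_def)
  show "fps_sums x w (1 + \<kappa> * y ^ k)" unfolding w_def
    by (intro fps_sums_add fps_sums_mult fps_sums_1 fps_sums_const fps_sums_power assms kap0 x)
  show "fps_sums x r (q * y)" unfolding r_def
    by (intro fps_sums_mult fps_sums_const assms q0 x)
  show "fps_sums x (pu * fsg i) (p * y * sg i y)" if "i \<le> 2" unfolding pu_def fsg_def sg_def using that
    by (intro fps_sums_mult fps_sums_sum fps_sums_const fps_sums_power assms p01 x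
        mult_nonneg_nonneg zero_le_power q0 U_nonneg finite_lessThan) auto
qed

lemma a_sums:
  assumes "fps_sums x u y" "p * y * sg 0 y < 1"
  shows "fps_sums x a (p * y * sg 1 y / (1 - p * y * sg 0 y))"
  using assms by (intro fps_sums_solution[OF a_eq] fsg_sums) (auto simp: pu_0)

text \<open>Eliminating \<open>L1\<close> is a Schur complement: \<open>1 - d\<close> takes the
  value \<open>det y\<close> over \<open>1 - p y sg 0 y\<close>.\<close>

lemma d_sums:
  assumes "fps_sums x u y" "p * y * sg 0 y < 1"
  shows "fps_sums x d (1 - det y / (1 - p * y * sg 0 y))"
proof -
  have "fps_sums x d (p * y * sg 2 y + p * y * sg 1 y * (p * y * sg 1 y / (1 - p * y * sg 0 y)))"
    unfolding d_def by (intro fps_sums_add fps_sums_mult[OF fsg_sums a_sums] fsg_sums assms) auto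
  also have "p * y * sg 2 y + p * y * sg 1 y * (p * y * sg 1 y / (1 - p * y * sg 0 y)) =
      1 - det y / (1 - p * y * sg 0 y)"
  proof -
    have "1 - p * y * sg 0 y \<noteq> 0" using assms by simp
    then show ?thesis by (simp add: det_def diff_divide_distrib power2_eq_square)
  qed
  finally show ?thesis .
qed

section \<open>Toss steps on pairs of consecutive terms\<close>

definition plus_step :: "real \<times> real \<Rightarrow> real \<times> real" where
  "plus_step v = (snd v, \<Lambda> * snd v + fst v)"

definition minus_step :: "real \<times> real \<Rightarrow> real \<times> real" where
  "minus_step v = (snd v, \<bar>\<Lambda> * snd v - fst v\<bar>)"

text \<open>Conditions on the first toss, which suits the generating function; the sequence itself
  extends by its last toss, and \<open>expectation_E\<close> reconciles the two.\<close>

primrec E :: "nat \<Rightarrow> real \<times> real \<Rightarrow> real" where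
  "E 0 v = snd v"
| "E (Suc n) v = p * E n (plus_step v) + q * E n (minus_step v)"

definition quadrant :: "(real \<times> real) set" where
  "quadrant = {v. 0 \<le> fst v \<and> 0 \<le> snd v}"

lemma plus_quadrant: "v \<in> quadrant \<Longrightarrow> plus_step v \<in> quadrant"
  and minus_quadrant: "v \<in> quadrant \<Longrightarrow> minus_step v \<in> quadrant"
  using lam_ge1 by (auto simp: quadrant_def plus_step_def minus_step_def)

lemma minus_pow_quadrant: "v \<in> quadrant \<Longrightarrow> (minus_step ^^ j) v \<in> quadrant"
  by (induction j) (auto simp: minus_quadrant)

text \<open>Nonnegativity of \<open>U\<close> up to index \<open>k\<close> keeps the linear values
  nonnegative, so the absolute values are inactive.\<close>

lemma minus_pow_plus:
  assumes v: "v \<in> quadrant" and j: "j \<le> k - 2"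
  shows "(minus_step ^^ j) (plus_step v) =
    (U (j + 1) * snd v + U j * fst v, U (j + 2) * snd v + U (j + 1) * fst v)"
  using j
proof (induction j)
  case 0
  then show ?case using U_rec[of 0] by (simp add: plus_step_def U_0 U_1 numeral_2_eq_2)
next
  case (Suc j)
  have "0 \<le> U (j + 3) * snd v + U (j + 2) * fst v"
    using Suc v k3 by (intro add_nonneg_nonneg mult_nonneg_nonneg U_nonneg) (auto simp: quadrant_def)
  moreover have "\<Lambda> * (U (j + 2) * snd v + U (j + 1) * fst v) - (U (j + 1) * snd v + U j * fst v) =
      U (j + 3) * snd v + U (j + 2) * fst v"
  proof -
    have "U (j + 2) = \<Lambda> * U (j + 1) - U j" "U (j + 3) = \<Lambda> * U (j + 2) - U (j + 1)"
      using U_rec[of j] U_rec[of "Suc j"] by (simp_all add: numeral_2_eq_2 numeral_3_eq_3)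
    then show ?thesis by algebra
  qed
  ultimately show ?case
    using Suc by (simp add: minus_step_def numeral_2_eq_2 numeral_3_eq_3)
qed

text \<open>After \<open>k - 2\<close> minus steps the pair is
  \<open>(snd v + \<Lambda> * fst v, fst v)\<close>; the next linear value is
  \<open>- snd v\<close>, and its absolute value closes the loop.\<close>

lemma minus_pow_plus_id:
  assumes v: "v \<in> quadrant"
  shows "(minus_step ^^ (k - 1)) (plus_step v) = v"
proof -
  have k: "k - 1 = Suc (k - 2)" and "k - 2 + 1 = k - 1" "k - 2 + 2 = k" using k3 by auto
  then have "U (k - 2 + 1) = 1" "U (k - 2 + 2) = 0" using U_k U_k1 by metis+
  then have "(minus_step ^^ (k - 2)) (plus_step v) = (snd v + \<Lambda> * fst v, fst v)"
    using minus_pow_plus[OF v order_refl] U_k2 by (simp only:) simp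
  then show ?thesis
    unfolding k using v by (simp add: minus_step_def quadrant_def prod_eq_iff)
qed

text \<open>The quadratic form preserved by the linear \<open>-\<close> step. It is positive
  definite as \<open>\<Lambda> < 2\<close>, and on the quadrant the absolute value can only lower
  it, so \<open>-\<close> orbits are bounded.\<close>

definition energy :: "real \<times> real \<Rightarrow> real" where
  "energy v = (fst v)\<^sup>2 - \<Lambda> * fst v * snd v + (snd v)\<^sup>2"

lemma energy_minus: "v \<in> quadrant \<Longrightarrow> energy (minus_step v) \<le> energy v"
proof -
  assume v: "v \<in> quadrant"
  have "energy (minus_step v) = energy v - \<Lambda> * snd v * (\<bar>\<Lambda> * snd v - fst v\<bar> - (\<Lambda> * snd v - fst v))"
    by (simp add: energy_def minus_step_def power2_eq_square algebra_simps)
  moreover have "0 \<le> \<Lambda> * snd v * (\<bar>\<Lambda> * snd v - fst v\<bar> - (\<Lambda> * snd v - fst v))"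
    using v lam_ge1 by (intro mult_nonneg_nonneg) (auto simp: quadrant_def)
  ultimately show ?thesis by simp
qed

lemma minus_bounded:
  assumes v: "v \<in> quadrant"
  obtains C where "0 \<le> C" "\<And>j. fst ((minus_step ^^ j) v) \<le> C" "\<And>j. snd ((minus_step ^^ j) v) \<le> C"
proof -
  define C where "C = sqrt (energy v / (1 - \<Lambda> / 2))"
  have e: "energy ((minus_step ^^ j) v) \<le> energy v" for j
  proof (induction j)
    case (Suc j)
    then show ?case using energy_minus[OF minus_pow_quadrant[OF v, of j]] by simp
  qed simp
  have b: "(fst z)\<^sup>2 + (snd z)\<^sup>2 \<le> energy z / (1 - \<Lambda> / 2)" for z
  proof -
    have "(1 - \<Lambda> / 2) * ((fst z)\<^sup>2 + (snd z)\<^sup>2) + \<Lambda> / 2 * (fst z - snd z)\<^sup>2 = energy z"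
      by (simp add: energy_def power2_eq_square field_simps)
    moreover have "0 \<le> \<Lambda> / 2 * (fst z - snd z)\<^sup>2" using lam_ge1 by simp
    ultimately have "(1 - \<Lambda> / 2) * ((fst z)\<^sup>2 + (snd z)\<^sup>2) \<le> energy z" by linarith
    then show ?thesis using lam_lt2 by (simp add: pos_le_divide_eq mult.commute)
  qed
  have c: "(fst ((minus_step ^^ j) v))\<^sup>2 + (snd ((minus_step ^^ j) v))\<^sup>2 \<le> energy v / (1 - \<Lambda> / 2)" for j
    using b[of "(minus_step ^^ j) v"] divide_right_mono[OF e[of j], of "1 - \<Lambda> / 2"] lam_lt2 by linarith
  have "fst ((minus_step ^^ j) v) \<le> C" "snd ((minus_step ^^ j) v) \<le> C" for j
    unfolding C_def using c[of j] zero_le_power2[of "fst ((minus_step ^^ j) v)"]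
      zero_le_power2[of "snd ((minus_step ^^ j) v)"] by (intro real_le_rsqrt; linarith)+
  moreover have "0 \<le> C" using c[of 0] zero_le_power2[of "fst v"] zero_le_power2[of "snd v"]
    unfolding C_def funpow_0 by (intro real_sqrt_ge_zero) linarith
  ultimately show thesis using that by blast
qed

section \<open>Closed form of the generating function\<close>

definition XR :: "real \<times> real \<Rightarrow> real fps" where
  "XR v = Abs_fps (\<lambda>j. fst ((minus_step ^^ j) v)) oo r"

definition YR :: "real \<times> real \<Rightarrow> real fps" where
  "YR v = Abs_fps (\<lambda>j. snd ((minus_step ^^ j) v)) oo r"

lemma XR_eq: "XR v = fps_const (fst v) + r * XR (minus_step v)"
  and YR_eq: "YR v = fps_const (snd v) + r * YR (minus_step v)"
  using fps_compose_Abs_fps[OF r_0, of "\<lambda>j. fst ((minus_step ^^ j) v)"]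
    fps_compose_Abs_fps[OF r_0, of "\<lambda>j. snd ((minus_step ^^ j) v)"]
  by (simp_all only: XR_def YR_def funpow_Suc_right o_apply funpow_0)

definition L2 :: "real fps" where "L2 = w * inverse (1 - d)"

lemma L2_eq: "L2 = w + d * L2"
proof -
  have "inverse (1 - d) * (1 - d) = 1"
    by (rule inverse_mult_eq_1) (simp add: d_0)
  then show ?thesis unfolding L2_def by algebra
qed

text \<open>\<open>XR\<close> and \<open>YR\<close> sum the orbit of \<open>v\<close> over the
  length of the initial net \<open>-\<close> run, with weight \<open>r ^ j\<close>; the row vector
  \<open>(a * L2, L2)\<close> accounts for the rest of the word. That the coefficients are
  \<open>E n v\<close> is checked by \<open>G_step\<close> and \<open>E_G\<close>.\<close>

definition G :: "real \<times> real \<Rightarrow> real fps" where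
  "G v = a * L2 * XR v + L2 * YR v"

lemma G_eq: "G v = w * (a * XR v + YR v) + d * G v"
proof -
  have "G v = L2 * (a * XR v + YR v)" by (simp add: G_def algebra_simps)
  also have "\<dots> = (w + d * L2) * (a * XR v + YR v)" using L2_eq by simp
  also have "\<dots> = w * (a * XR v + YR v) + d * (L2 * (a * XR v + YR v))" by (simp add: algebra_simps)
  also have "L2 * (a * XR v + YR v) = G v" by (simp add: G_def algebra_simps)
  finally show ?thesis .
qed

lemma G_minus: "G v = fps_const (fst v) * (a * L2) + fps_const (snd v) * L2 + r * G (minus_step v)"
  unfolding G_def XR_eq[of v] YR_eq[of v] by (simp add: algebra_simps)

lemma G_minus_pow:
  "G v = (\<Sum>j<n. r ^ j * (fps_const (fst ((minus_step ^^ j) v)) * (a * L2)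
      + fps_const (snd ((minus_step ^^ j) v)) * L2)) + r ^ n * G ((minus_step ^^ n) v)"
proof (induction n)
  case (Suc n)
  note Suc
  also have "G ((minus_step ^^ n) v) = fps_const (fst ((minus_step ^^ n) v)) * (a * L2)
      + fps_const (snd ((minus_step ^^ n) v)) * L2 + r * G ((minus_step ^^ Suc n) v)"
    using G_minus[of "(minus_step ^^ n) v"] by simp
  finally show ?case by (simp add: algebra_simps del: funpow.simps)
qed simp

text \<open>The first \<open>k - 1\<close> orbit terms are linear in \<open>v\<close> by
  \<open>minus_pow_plus\<close>, and then the orbit is back at \<open>v\<close>, so the tail is
  again \<open>G v\<close>.\<close>

lemma G_plus:
  assumes v: "v \<in> quadrant"
  shows "G (plus_step v) = (fps_const (snd v) * fsg 1 + fps_const (fst v) * fsg 0) * (a * L2)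
    + (fps_const (snd v) * fsg 2 + fps_const (fst v) * fsg 1) * L2 + r ^ (k - 1) * G v"
proof -
  have "(\<Sum>j<k - 1. r ^ j * (fps_const (fst ((minus_step ^^ j) (plus_step v))) * (a * L2)
      + fps_const (snd ((minus_step ^^ j) (plus_step v))) * L2)) =
    (\<Sum>j<k - 1. (fps_const (snd v) * (fps_const (q ^ j * U (j + 1)) * u ^ j) +
      fps_const (fst v) * (fps_const (q ^ j * U (j + 0)) * u ^ j)) * (a * L2) +
     (fps_const (snd v) * (fps_const (q ^ j * U (j + 2)) * u ^ j) +
      fps_const (fst v) * (fps_const (q ^ j * U (j + 1)) * u ^ j)) * L2)" (is "_ = ?S")
  proof (rule sum.cong[OF refl])
    fix j assume "j \<in> {..<k - 1}"
    then have j: "j \<le> k - 2" by auto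
    have rj: "r ^ j = fps_const (q ^ j) * u ^ j" by (simp add: r_def power_mult_distrib fps_const_power)
    show "r ^ j * (fps_const (fst ((minus_step ^^ j) (plus_step v))) * (a * L2)
      + fps_const (snd ((minus_step ^^ j) (plus_step v))) * L2) =
      (fps_const (snd v) * (fps_const (q ^ j * U (j + 1)) * u ^ j) +
      fps_const (fst v) * (fps_const (q ^ j * U (j + 0)) * u ^ j)) * (a * L2) +
     (fps_const (snd v) * (fps_const (q ^ j * U (j + 2)) * u ^ j) +
      fps_const (fst v) * (fps_const (q ^ j * U (j + 1)) * u ^ j)) * L2"
      unfolding minus_pow_plus[OF v j] rj fst_conv snd_conv
      by (simp only: fps_const_add[symmetric] fps_const_mult[symmetric] add_0_right) (simp only: algebra_simps)
  qed
  also have "?S = (fps_const (snd v) * fsg 1 + fps_const (fst v) * fsg 0) * (a * L2)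
    + (fps_const (snd v) * fsg 2 + fps_const (fst v) * fsg 1) * L2"
    by (simp only: fsg_def sum.distrib sum_distrib_left sum_distrib_right distrib_right)
  finally show ?thesis
    using G_minus_pow[of "plus_step v" "k - 1"] minus_pow_plus_id[OF v] by simp
qed

lemma G_step:
  assumes v: "v \<in> quadrant"
  shows "G v = fps_const (snd v) + fps_X * (fps_const p * G (plus_step v) + fps_const q * G (minus_step v))"
    (is "_ = ?R")
proof -
  define P Q R x y where "P = fps_const p" "Q = fps_const q" "R = r ^ (k - 1)" "x = fps_const (fst v)" "y = fps_const (snd v)"
  note defs = P_Q_R_x_y_def
  have w: "w = 1 + P * R * u"
  proof -
    have "u ^ k = u ^ (k - 1) * u" using k3 by (cases k) auto
    moreover have "fps_const \<kappa> = fps_const p * fps_const q ^ (k - 1)" by (simp add: kap_eq)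
    ultimately show ?thesis
      unfolding w_def P_Q_R_x_y_def r_def by (simp only: power_mult_distrib mult_ac)
  qed
  have u: "u = fps_X * w" by (rule u_w)
  have r: "r = Q * u" by (simp add: r_def defs)
  have pu: "pu = P * u" by (simp add: pu_def defs)
  have a: "a = P * u * fsg 1 + P * u * fsg 0 * a" using a_eq unfolding pu .
  have L: "L2 = w + (P * u * fsg 2 + P * u * fsg 1 * a) * L2" using L2_eq unfolding d_def pu .
  have G1: "G v = x * (a * L2) + y * L2 + r * G (minus_step v)"
    unfolding defs by (rule G_minus)
  have G2: "G (plus_step v) = (y * fsg 1 + x * fsg 0) * (a * L2) + (y * fsg 2 + x * fsg 1) * L2 + R * G v"
    unfolding defs by (rule G_plus[OF v])
  \<comment> \<open>Multiplication by the nonzero \<open>w\<close> turns \<open>X\<close> into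
    \<open>u\<close>, so that \<open>a_eq\<close> and \<open>L2_eq\<close> apply.\<close>
  have "w * G v = w * (y + fps_X * (P * G (plus_step v) + Q * G (minus_step v)))"
  proof -
    have "w * (y + fps_X * (P * G (plus_step v) + Q * G (minus_step v))) =
        w * y + P * u * G (plus_step v) + r * G (minus_step v)"
      unfolding r using u by algebra
    also have "P * u * G (plus_step v) =
        x * ((P * u * fsg 1 + P * u * fsg 0 * a) * L2) + y * ((P * u * fsg 2 + P * u * fsg 1 * a) * L2) + P * u * R * G v"
      unfolding G2 by (simp add: algebra_simps)
    also have "(P * u * fsg 1 + P * u * fsg 0 * a) = a" using a by simp
    also have "(P * u * fsg 2 + P * u * fsg 1 * a) * L2 = L2 - w" using L by (simp add: algebra_simps)
    also have "w * y + (x * (a * L2) + y * (L2 - w) + P * u * R * G v) + r * G (minus_step v) = w * G v"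
      using G1 w by algebra
    finally show ?thesis ..
  qed
  moreover have "w \<noteq> 0" using w_0 by auto
  ultimately show ?thesis by (simp add: defs)
qed

lemma E_G: "v \<in> quadrant \<Longrightarrow> E n v = G v $ n"
proof (induction n arbitrary: v)
  case 0
  then show ?case by (subst G_step) auto
next
  case (Suc n)
  then show ?case by (subst G_step) (auto simp: plus_quadrant minus_quadrant)
qed

end

section \<open>Growth of the expectations\<close>

lemma fps_sums_dominated:
  assumes f: "fps_nonneg f" and g: "fps_sums x g c" and le: "\<And>n. f $ n \<le> C * g $ n"
  obtains t where "fps_sums x f t"
proof -
  have x: "0 \<le> x" and s: "(\<lambda>n. g $ n * x ^ n) sums c" using g by (auto simp: fps_sums_def)
  have "summable (\<lambda>n. f $ n * x ^ n)"
  proof (rule summable_comparison_test)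
    show "\<exists>N. \<forall>n\<ge>N. norm (f $ n * x ^ n) \<le> C * (g $ n * x ^ n)"
      using le x fps_nonnegD[OF f] by (auto simp: mult.assoc[symmetric] intro!: mult_right_mono)
    show "summable (\<lambda>n. C * (g $ n * x ^ n))"
      using s by (intro summable_mult sums_summable)
  qed
  with f x that show thesis by (auto simp: fps_sums_def summable_def)
qed

context fib
begin

text \<open>The geometric series in \<open>r\<close>; since \<open>-\<close> orbits are bounded, it
  dominates \<open>XR v\<close> and \<open>YR v\<close> up to a constant.\<close>

definition H :: "real fps" where "H = Abs_fps (\<lambda>_. 1) oo r"

lemma H_eq: "H = 1 + r * H"
  using fps_compose_Abs_fps[OF r_0, of "\<lambda>_. 1"] by (simp add: H_def)

lemma XR_YR_bounds:
  assumes v: "v \<in> quadrant"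
  obtains C where "0 \<le> C" "fps_nonneg (XR v)" "fps_nonneg (YR v)"
    "\<And>n. XR v $ n \<le> C * H $ n" "\<And>n. YR v $ n \<le> C * H $ n"
proof -
  obtain C where C: "0 \<le> C" "\<And>j. fst ((minus_step ^^ j) v) \<le> C" "\<And>j. snd ((minus_step ^^ j) v) \<le> C"
    using minus_bounded[OF v] by blast
  have nn: "0 \<le> fst ((minus_step ^^ j) v)" "0 \<le> snd ((minus_step ^^ j) v)" for j
    using minus_pow_quadrant[OF v, of j] by (auto simp: quadrant_def)
  show thesis
    by (rule that[OF C(1)]; unfold XR_def YR_def H_def fps_nonneg_def)
      (intro allI fps_compose_le[OF r_nonneg nn(1) C(2)] fps_compose_le[OF r_nonneg nn(2) C(3)])+
qed

text \<open>On the branch this is the inverse function of \<open>u\<close>.\<close>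

definition Z :: "real \<Rightarrow> real" where "Z y = y / (1 + \<kappa> * y ^ k)"

lemma fixed_denominator_pos: "0 \<le> y \<Longrightarrow> 0 < 1 + \<kappa> * y ^ k"
  using kap0 by (intro add_pos_nonneg) auto

text \<open>Convexity transports the facts from \<open>tc\<close> to all smaller \<open>y\<close>:
  the slope stays below 1, so the gap \<open>1 + \<kappa> y^k - y\<close> is smallest at
  \<open>tc\<close>.\<close>

lemma u_sums_Z:
  assumes pc: "fib_crit k < p" and y: "0 \<le> y" "y \<le> tc"
  shows "y < 1 + \<kappa> * y ^ k" "\<kappa> * real k * y ^ (k - 1) < 1" "Z y < 1" "fps_sums (Z y) u y"
proof -
  have "\<kappa> * (tc ^ k - y ^ k) \<le> \<kappa> * (real k * tc ^ (k - 1) * (tc - y))"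
    using power_diff_le[OF y] kap0 by (intro mult_left_mono)
  also have "\<dots> = \<kappa> * real k * tc ^ (k - 1) * (tc - y)" by simp
  also have "\<dots> \<le> 1 * (tc - y)"
    using tc_deriv[OF pc] y by (intro mult_right_mono) auto
  finally show f: "y < 1 + \<kappa> * y ^ k" using tc_fixed[OF pc] by (simp add: right_diff_distrib)
  have "\<kappa> * real k * y ^ (k - 1) \<le> \<kappa> * real k * tc ^ (k - 1)"
    using y kap0 by (intro mult_left_mono power_mono) auto
  then show c: "\<kappa> * real k * y ^ (k - 1) < 1" using tc_deriv[OF pc] by simp
  have pos: "0 < 1 + \<kappa> * y ^ k" using fixed_denominator_pos y by blast
  then show Z1: "Z y < 1" using f by (simp add: Z_def)
  have Z0: "0 \<le> Z y" using pos y by (simp add: Z_def)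
  have "Z y * (\<kappa> * real k * y ^ (k - 1)) \<le> 1 * (\<kappa> * real k * y ^ (k - 1))"
    using Z1 y kap0 by (intro mult_right_mono) auto
  then have "Z y * \<kappa> * real k * y ^ (k - 1) < 1" using c by (simp add: mult.assoc)
  then show "fps_sums (Z y) u y"
    using pos by (intro fps_branch_sums[OF u u_nonneg kap0 y(1) Z0]) (auto simp: Z_def)
qed

lemma Z_strict_mono:
  assumes pc: "fib_crit k < p" and st: "0 \<le> s" "s < t" "t \<le> tc"
  shows "Z s < Z t"
proof -
  have pos: "0 < 1 + \<kappa> * s ^ k" "0 < 1 + \<kappa> * t ^ k" using fixed_denominator_pos st by auto
  have "s * (\<kappa> * (t ^ k - s ^ k)) \<le> s * (\<kappa> * (real k * t ^ (k - 1) * (t - s)))"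
    using power_diff_le[of s t k] st kap0 by (intro mult_left_mono) auto
  also have "\<dots> = s * (\<kappa> * real k * t ^ (k - 1)) * (t - s)" by simp
  also have "\<dots> \<le> s * 1 * (t - s)"
    using u_sums_Z(2)[OF pc, of t] st by (intro mult_right_mono mult_left_mono) auto
  also have "\<dots> < (1 + \<kappa> * s ^ k) * (t - s)"
    using u_sums_Z(1)[OF pc, of s] st by (intro mult_strict_right_mono) auto
  finally have "s * (1 + \<kappa> * t ^ k) < t * (1 + \<kappa> * s ^ k)" by (simp add: algebra_simps)
  then show ?thesis using pos by (simp add: Z_def divide_less_eq less_divide_eq mult.commute)
qed

lemma fib_crit_pos: "0 < fib_crit k"
  using lam_lt2 by (simp add: fib_crit_def lam_eq)

text \<open>At \<open>z = Z t\<close> the weights \<open>d $ n * z ^ n\<close> sum to 1 because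
  \<open>det t = 0\<close>. The renewal theorem makes \<open>E n v * z ^ n\<close> converge to a
  positive limit, so the ratio tends to \<open>1 / z\<close>.\<close>

lemma supercritical_growth:
  assumes pc: "fib_crit k < p" and v: "v \<in> quadrant" "0 < snd v"
  obtains t where "0 < t" "D t = 0" "1 < (1 + \<kappa> * t ^ k) / t"
    "(\<lambda>n. E (Suc n) v / E n v) \<longlonglongrightarrow> (1 + \<kappa> * t ^ k) / t"
proof -
  have p: "0 < p" using pc fib_crit_pos by simp
  obtain t where t: "0 < t" "t < tc" "D t = 0" using D_root_exists[OF pc] by blast
  \<comment> \<open>A point \<open>t'\<close> slightly beyond \<open>t\<close> still has
    \<open>A t' < 1\<close>; convergence of \<open>d\<close> at \<open>Z t' > Z t\<close> is the
    exponential moment for \<open>renewal\<close>.\<close>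
  define A where "A y = p * y * sg 0 y" for y
  have At: "A t < 1" unfolding A_def by (rule root_factors_pos[OF t(1) p t(3)])
  have "continuous_on UNIV A" unfolding A_def sg_def by (intro continuous_intros)
  then have "(A \<longlongrightarrow> A t) (at_right t)"
    by (auto simp: continuous_on_def intro: tendsto_within_subset)
  then have "eventually (\<lambda>y. A y < 1) (at_right t)" using At by (rule order_tendstoD)
  moreover have "eventually (\<lambda>y. y \<in> {t<..<tc}) (at_right t)" by (rule eventually_at_right_real[OF t(2)])
  ultimately have "eventually (\<lambda>y. A y < 1 \<and> y \<in> {t<..<tc}) (at_right t)" by (rule eventually_conj)
  then obtain t' where t': "A t' < 1" "t < t'" "t' < tc"
    using eventually_happens'[of "at_right t"] trivial_limit_at_right_real by auto
  define x where "x = Z t"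
  have x: "0 < x" "x < 1"
    using u_sums_Z(3)[OF pc, of t] t fixed_denominator_pos[of t] by (auto simp: x_def Z_def)
  have ux: "fps_sums x u t" using u_sums_Z[OF pc, of t] t by (simp add: x_def)
  have ux': "fps_sums (Z t') u t'" using u_sums_Z[OF pc, of t'] t t' by simp
  have xx': "x < Z t'" using Z_strict_mono[OF pc, of t t'] t t' by (simp add: x_def)
  have det: "det t = 0" using det_zero_iff t by simp
  have ds: "fps_sums x d 1" using d_sums[OF ux] At det by (simp add: A_def)
  have ds': "summable (\<lambda>n. d $ n * Z t' ^ n)"
    using d_sums[OF ux'] t' by (auto simp: A_def fps_sums_def sums_iff)
  have "q * t \<le> q * tc" using t q0 by (intro mult_left_mono) auto
  then have qt: "q * t < 1" using q_tc[OF pc] by simp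
  have Hs: "fps_sums x H (1 / (1 - q * t))"
    using x qt by (intro fps_sums_solution[OF H_eq] fps_sums_1 r_sums ux) (auto simp: r_0)
  obtain C where C: "fps_nonneg (XR v)" "fps_nonneg (YR v)"
    "\<And>n. XR v $ n \<le> C * H $ n" "\<And>n. YR v $ n \<le> C * H $ n"
    using XR_YR_bounds[OF v(1)] by metis
  obtain X Y where XY: "fps_sums x (XR v) X" "fps_sums x (YR v) Y"
    using fps_sums_dominated[OF C(1) Hs C(3)] fps_sums_dominated[OF C(2) Hs C(4)] by metis
  define b where "b = w * (a * XR v + YR v)"
  obtain \<beta> where bs: "fps_sums x b \<beta>"
    unfolding b_def using fps_sums_mult[OF w_sums[OF ux]] fps_sums_add fps_sums_mult[OF a_sums[OF ux]] At XY
    unfolding A_def by metis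
  have a0: "a $ 0 = 0" by (subst a_eq) (simp add: pu_0)
  have "YR v $ 0 = snd v" by (subst YR_eq) (simp add: r_0)
  then have "b $ 0 = snd v" by (simp add: b_def w_0 a0)
  then have "0 < \<beta>" using fps_sums_partial[OF bs, of 1] v(2) by simp
  define f where "f n = G v $ n * x ^ n" for n
  interpret ren: renewal "\<lambda>n. d $ n * x ^ n" "\<lambda>n. b $ n * x ^ n" f \<beta> "Z t' / x"
  proof
    show "0 < d $ 1 * x ^ 1" using d_1_pos[OF p] x by simp
    show "summable (\<lambda>n. d $ n * x ^ n * (Z t' / x) ^ n)"
      using ds' x by (simp add: power_divide)
    show "f n = b $ n * x ^ n + (\<Sum>j\<le>n. d $ j * x ^ j * f (n - j))" for n
    proof -
      have "f n = (b + d * G v) $ n * x ^ n" using G_eq[of v] by (simp add: f_def b_def)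
      then show ?thesis
        unfolding fps_add_nth distrib_right fps_mult_nth_scaled f_def .
    qed
  qed (use ds bs xx' x \<open>0 < \<beta>\<close> d_0 in \<open>auto simp: fps_sums_def fps_nonneg_def\<close>)
  obtain c where c: "0 < c" "f \<longlonglongrightarrow> c" using ren.renewal_limit by blast
  have "(\<lambda>n. f (Suc n) / f n / x) \<longlonglongrightarrow> c / c / x"
    using c x by (intro tendsto_divide[OF tendsto_divide[OF LIMSEQ_Suc] tendsto_const]) auto
  moreover have "f (Suc n) / f n / x = E (Suc n) v / E n v" for n
    using x by (simp add: f_def E_G[OF v(1)])
  moreover have "c / c / x = (1 + \<kappa> * t ^ k) / t" using c t by (simp add: x_def Z_def)
  ultimately have "(\<lambda>n. E (Suc n) v / E n v) \<longlonglongrightarrow> (1 + \<kappa> * t ^ k) / t" by simp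
  moreover have "1 < (1 + \<kappa> * t ^ k) / t" using u_sums_Z(1)[OF pc, of t] t by simp
  ultimately show thesis using that t by blast
qed

text \<open>Everything is evaluated at \<open>z = 1\<close>, where \<open>u = 1 / q\<close>. There
  \<open>det\<close> has the sign of \<open>2 - 4 p - \<Lambda>\<close>, so \<open>d\<close> sums to
  at most 1, and to less below the critical value; comparison with a linear or a constant majorant
  finishes.\<close>

lemma subcritical_growth:
  assumes pc: "p \<le> fib_crit k" and v: "v \<in> quadrant"
  shows "\<exists>B. (\<forall>n. E n v \<le> B * (real n + 1)) \<and> (p < fib_crit k \<longrightarrow> (\<forall>n. E n v \<le> B))"
proof -
  have pl: "4 * p \<le> 2 - \<Lambda>" using pc by (simp add: fib_crit_def lam_eq)
  \<comment> \<open>\<open>p * k < 1\<close> is the slope condition of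
    \<open>fps_branch_sums\<close> at \<open>y = 1 / q\<close>.\<close>
  have "4 * p < 4 / k" using pl lam_gt by linarith
  then have pk: "p * k < 1" using k3 by (simp add: field_simps)
  have q: "0 < q" using pl lam_ge1 by (simp add: q_eq)
  define y where "y = 1 / q"
  have y: "0 < y" "q * y = 1" using q by (auto simp: y_def)
  have qy: "q ^ n * y ^ n = 1" for n using y(2) by (metis power_mult_distrib power_one)
  have "q ^ (k - 1) * y ^ k = y"
  proof -
    have "y ^ k = y ^ (k - 1) * y" using k3 by (cases k) auto
    then show ?thesis using qy[of "k - 1"] by simp
  qed
  then have ky: "\<kappa> * y ^ k = p * y" by (simp add: kap_eq)
  have us: "fps_sums 1 u y"
  proof (rule fps_branch_sums[OF u u_nonneg kap0])
    have "1 * \<kappa> * real k * y ^ (k - 1) = p * k * (q ^ (k - 1) * y ^ (k - 1))" by (simp add: kap_eq)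
    also have "\<dots> < 1" using pk unfolding qy by simp
    finally show "1 * \<kappa> * real k * y ^ (k - 1) < 1" .
    show "y = 1 * (1 + \<kappa> * y ^ k)" unfolding ky using y by (simp add: q_eq algebra_simps)
  qed (use y in auto)
  have s1: "(2 - \<Lambda>) * sg 1 y = 2" using sg_1[of y] unfolding y(2) by simp
  have s0: "sg 0 y = sg 1 y - 1" using sg_0[of y] unfolding y(2) by simp
  have A: "p * y * sg 0 y < 1"
  proof -
    have "(2 - \<Lambda>) * (p * sg 0 y) = p * ((2 - \<Lambda>) * sg 1 y - (2 - \<Lambda>))"
      by (simp add: s0 algebra_simps)
    also have "\<dots> = p * \<Lambda>" unfolding s1 by simp
    also have "\<dots> < (2 - \<Lambda>) * q"
    proof -
      have "p * \<Lambda> \<le> (2 - \<Lambda>) / 4 * \<Lambda>" using pl lam_ge1 by (intro mult_right_mono) auto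
      also have "\<dots> < (2 - \<Lambda>) * ((2 + \<Lambda>) / 4)" using lam_lt2 by (simp add: field_simps)
      also have "\<dots> \<le> (2 - \<Lambda>) * q" using pl lam_lt2 by (intro mult_left_mono) (auto simp: q_eq)
      finally show ?thesis .
    qed
    finally have "p * sg 0 y < q" using lam_lt2 by simp
    then show ?thesis using q by (simp add: y_def field_simps)
  qed
  define \<delta> where "\<delta> = 1 - det y / (1 - p * y * sg 0 y)"
  have ds: "fps_sums 1 d \<delta>" unfolding \<delta>_def by (rule d_sums[OF us A])
  have "D y = (2 - 4 * p - \<Lambda>) * y\<^sup>2"
  proof -
    have "D y = 1 - \<Lambda> * y - (2 * p - 1) * y\<^sup>2 - \<Lambda> * y * (\<kappa> * y ^ k) - (\<kappa> * y ^ k)\<^sup>2"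
      by (simp add: D_def power_mult_distrib power_mult[symmetric] mult.commute)
    also have "\<dots> = (2 - 4 * p - \<Lambda>) * y\<^sup>2"
      unfolding ky using y(2) unfolding q_eq by algebra
    finally show ?thesis .
  qed
  then have det_y: "(2 - \<Lambda>) * det y = (2 - 4 * p - \<Lambda>) * y\<^sup>2" using det_D[of y] unfolding y(2) by simp
  have \<delta>: "0 \<le> \<delta>" "\<delta> \<le> 1"
  proof -
    show "0 \<le> \<delta>" using fps_sums_ge0[OF ds] .
    have "0 \<le> (2 - \<Lambda>) * det y" unfolding det_y using pl by simp
    then have "0 \<le> det y" using lam_lt2 by (simp add: zero_le_mult_iff)
    then show "\<delta> \<le> 1" using A by (simp add: \<delta>_def)
  qed
  have \<delta>': "\<delta> < 1" if "p < fib_crit k"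
  proof -
    have "0 < (2 - \<Lambda>) * det y" unfolding det_y using that y by (simp add: fib_crit_def lam_eq)
    then have "0 < det y" using lam_lt2 by (simp add: zero_less_mult_iff)
    then show ?thesis using A by (simp add: \<delta>_def)
  qed
  \<comment> \<open>Since \<open>r\<close> sums to 1 here, \<open>fps_sums_solution\<close> does not
    apply to \<open>H\<close>; its coefficients are bounded instead.\<close>
  have rs: "fps_sums 1 r 1" using r_sums[OF us] y by simp
  have H1: "H $ n \<le> 1" for n
    by (rule fps_solution_coeff_le[OF H_eq rs r_0]) (auto intro: fps_nonneg_const[of 1, simplified] monoI)
  obtain C where C: "0 \<le> C" "fps_nonneg (XR v)" "fps_nonneg (YR v)"
    "\<And>n. XR v $ n \<le> C * H $ n" "\<And>n. YR v $ n \<le> C * H $ n"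
    using XR_YR_bounds[OF v] by metis
  have CH: "C * H $ n \<le> C" for n using mult_left_mono[OF H1 C(1)] by simp
  have XC: "XR v $ n \<le> C" and YC: "YR v $ n \<le> C" for n
    using C(4)[of n] C(5)[of n] CH[of n] by auto
  obtain \<phi>a \<phi>w where as: "fps_sums 1 a \<phi>a" and ws: "fps_sums 1 w \<phi>w"
    using a_sums[OF us A] w_sums[OF us] by blast
  define b where "b = w * (a * XR v + YR v)"
  define B where "B = \<phi>w * (\<phi>a * C + C)"
  have bn: "fps_nonneg b"
    unfolding b_def by (intro fps_nonneg_mult fps_nonneg_add w_nonneg a_nonneg C)
  have B: "b $ n \<le> B" for n
    unfolding b_def B_def
  proof (rule fps_mult_coeff_le[OF ws])
    show "0 \<le> (a * XR v + YR v) $ n" for n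
      by (intro fps_nonnegD fps_nonneg_mult fps_nonneg_add a_nonneg C)
    show "(a * XR v + YR v) $ n \<le> \<phi>a * C + C" for n
      using fps_mult_coeff_le[OF as fps_nonnegD[OF C(2)] XC, of n] YC[of n] by simp
  qed
  have B0: "0 \<le> B" using B[of 0] fps_nonnegD[OF bn, of 0] by simp
  have Gb: "G v = b + d * G v" unfolding b_def by (rule G_eq)
  have lin: "E n v \<le> B * (real n + 1)" for n
    unfolding E_G[OF v]
  proof (rule fps_solution_coeff_le[OF Gb ds d_0 bn])
    show "b $ Suc n + \<delta> * (B * (real n + 1)) \<le> B * (real (Suc n) + 1)" for n
    proof -
      have "\<delta> * (B * (real n + 1)) \<le> 1 * (B * (real n + 1))" using \<delta> B0 by (intro mult_right_mono) auto
      then show ?thesis using B[of "Suc n"] by (simp add: algebra_simps)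
    qed
  qed (use B B0 in \<open>auto intro!: monoI mult_left_mono\<close>)
  show ?thesis
  proof (cases "p < fib_crit k")
    case True
    define S where "S = B / (1 - \<delta>)"
    have SB: "B = S * (1 - \<delta>)" using \<delta>'[OF True] by (simp add: S_def)
    have S0: "0 \<le> S" using B0 \<delta>'[OF True] by (simp add: S_def)
    have "E n v \<le> S" for n
      unfolding E_G[OF v]
    proof (rule fps_solution_coeff_le[OF Gb ds d_0 bn])
      show "b $ Suc n + \<delta> * S \<le> S" for n
        using B[of "Suc n"] unfolding SB by (simp add: algebra_simps)
      have "B \<le> S * 1" unfolding SB using S0 \<delta> by (intro mult_left_mono) auto
      then show "b $ 0 \<le> S" using B[of 0] by simp
    qed (use S0 in \<open>auto intro!: monoI\<close>)
    then have b1: "E n v \<le> max B S" for n by (simp add: le_max_iff_disj)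
    have "B * (real n + 1) \<le> max B S * (real n + 1)" for n
      by (intro mult_right_mono) auto
    with lin have "E n v \<le> max B S * (real n + 1)" for n by (meson order_trans)
    with b1 show ?thesis by blast
  next
    case False
    with lin show ?thesis by blast
  qed
qed

end

section \<open>The random walk\<close>

context fib
begin

text \<open>Tosses are indexed from 3, so the state after \<open>n\<close> steps is the pair of
  terms \<open>n + 1\<close> and \<open>n + 2\<close>.\<close>

primrec state :: "real \<times> real \<Rightarrow> (nat \<Rightarrow> bool) \<Rightarrow> nat \<Rightarrow> real \<times> real" where
  "state v s 0 = v"
| "state v s (Suc n) = (if s (n + 3) then plus_step else minus_step) (state v s n)"

lemma state_cong: "(\<And>i. i \<in> {3..<n + 3} \<Longrightarrow> s i = s' i) \<Longrightarrow> state v s n = state v s' n"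
  by (induction n) auto

lemma state_quadrant: "v \<in> quadrant \<Longrightarrow> state v s n \<in> quadrant"
  by (induction n) (auto simp: plus_quadrant minus_quadrant)

end

locale fib_walk = fib + prob_space M for M :: "'a measure" +
  fixes toss :: "nat \<Rightarrow> 'a \<Rightarrow> bool"
  assumes toss_indep: "indep_vars (\<lambda>_. count_space UNIV) toss {3..}"
    and toss_prob: "\<And>n. 3 \<le> n \<Longrightarrow> prob {\<omega> \<in> space M. toss n \<omega>} = p"
begin

lemma PiM_bool: "finite A \<Longrightarrow> PiM A (\<lambda>_. count_space (UNIV :: bool set)) = count_space (PiE A (\<lambda>_. UNIV))"
  by (rule count_space_PiM_finite) auto

lemma toss_measurable: "3 \<le> n \<Longrightarrow> toss n \<in> measurable M (count_space UNIV)"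
  using toss_indep by (auto simp: indep_vars_def)

lemma prefix_measurable:
  assumes A: "finite A" "A \<subseteq> {3..}"
  shows "(\<lambda>\<omega>. restrict (\<lambda>i. toss i \<omega>) A) \<in> measurable M (count_space (PiE A (\<lambda>_. UNIV)))"
  unfolding PiM_bool[OF A(1), symmetric] using A(2) toss_measurable by (intro measurable_restrict) auto

text \<open>Finitely many Boolean tosses take finitely many values, so any \<open>h\<close> is
  bounded and measurable.\<close>

lemma prefix_integrable:
  fixes h :: "(nat \<Rightarrow> bool) \<Rightarrow> real"
  assumes A: "finite A" "A \<subseteq> {3..}"
  shows "integrable M (\<lambda>\<omega>. h (restrict (\<lambda>i. toss i \<omega>) A))"
proof (rule integrable_const_bound)
  have fin: "finite (PiE A (\<lambda>_. UNIV :: bool set))" using A by (intro finite_PiE) auto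
  show "AE \<omega> in M. norm (h (restrict (\<lambda>i. toss i \<omega>) A)) \<le> Max ((norm \<circ> h) ` PiE A (\<lambda>_. UNIV))"
    by (rule AE_I2) (use fin in \<open>auto intro!: Max_ge\<close>)
  show "(\<lambda>\<omega>. h (restrict (\<lambda>i. toss i \<omega>) A)) \<in> borel_measurable M"
    using measurable_compose[OF prefix_measurable[OF A], of h borel] by simp
qed

lemma prefix_independent:
  fixes h :: "(nat \<Rightarrow> bool) \<Rightarrow> real" and e :: "bool \<Rightarrow> real"
  shows "expectation (\<lambda>\<omega>. h (restrict (\<lambda>i. toss i \<omega>) {3..<n + 3}) * e (toss (n + 3) \<omega>)) =
    expectation (\<lambda>\<omega>. h (restrict (\<lambda>i. toss i \<omega>) {3..<n + 3})) * (p * e True + q * e False)"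
proof -
  let ?A = "{3..<n + 3}" and ?B = "{n + 3}"
  let ?X = "\<lambda>\<omega>. h (restrict (\<lambda>i. toss i \<omega>) ?A)" and ?Y = "\<lambda>\<omega>. e (restrict (\<lambda>i. toss i \<omega>) ?B (n + 3))"
  have "indep_var (PiM ?A (\<lambda>_. count_space UNIV)) (\<lambda>\<omega>. restrict (\<lambda>i. toss i \<omega>) ?A)
      (PiM ?B (\<lambda>_. count_space UNIV)) (\<lambda>\<omega>. restrict (\<lambda>i. toss i \<omega>) ?B)"
    by (rule indep_var_restrict[OF toss_indep]) auto
  then have "indep_var borel (h \<circ> (\<lambda>\<omega>. restrict (\<lambda>i. toss i \<omega>) ?A))
      borel ((\<lambda>s. e (s (n + 3))) \<circ> (\<lambda>\<omega>. restrict (\<lambda>i. toss i \<omega>) ?B))"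
    by (rule indep_var_compose) (simp_all add: PiM_bool)
  then have "indep_var borel ?X borel ?Y" by (simp only: o_def)
  moreover have "integrable M ?X" by (rule prefix_integrable) auto
  moreover have "integrable M ?Y"
    using prefix_integrable[of ?B "\<lambda>s. e (s (n + 3))"] by auto
  ultimately have "expectation (\<lambda>\<omega>. ?X \<omega> * ?Y \<omega>) = expectation ?X * expectation ?Y"
    by (rule indep_var_lebesgue_integral)
  moreover have "expectation ?Y = p * e True + q * e False"
  proof -
    have m: "{\<omega> \<in> space M. toss (n + 3) \<omega>} \<in> sets M"
      using measurable_sets[OF toss_measurable[of "n + 3"], of "{True}"] by (simp add: vimage_def Int_def conj_commute)
    have "expectation ?Y = expectation (\<lambda>\<omega>. (e True - e False) * indicator {\<omega> \<in> space M. toss (n + 3) \<omega>} \<omega> + e False)"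
      by (rule Bochner_Integration.integral_cong) (auto simp: indicator_def)
    also have "\<dots> = (e True - e False) * p + e False"
      using m toss_prob[of "n + 3"] by (simp add: prob_space emeasure_eq_measure)
    finally show ?thesis by (simp add: q_eq algebra_simps)
  qed
  ultimately show ?thesis by simp
qed

lemma state_restrict: "state v (restrict s {3..<n + 3}) n = state v s n"
  by (rule state_cong) simp

text \<open>The general \<open>j\<close> lets the induction absorb the last of \<open>n + 1\<close>
  tosses into \<open>E (Suc j)\<close>.\<close>

lemma expectation_E: "expectation (\<lambda>\<omega>. E j (state v (\<lambda>i. toss i \<omega>) n)) = E (n + j) v"
proof (induction n arbitrary: j)
  case 0
  then show ?case by (simp add: prob_space)
next
  case (Suc n)
  let ?S = "\<lambda>\<omega>. restrict (\<lambda>i. toss i \<omega>) {3..<n + 3}"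
  let ?hp = "\<lambda>s. E j (plus_step (state v s n))" and ?hm = "\<lambda>s. E j (minus_step (state v s n))"
  let ?ep = "\<lambda>t. if t then 1 else 0 :: real" and ?em = "\<lambda>t. if t then 0 else 1 :: real"
  have int: "integrable M (\<lambda>\<omega>. h (?S \<omega>) * e (toss (n + 3) \<omega>))" for h and e :: "bool \<Rightarrow> real"
  proof -
    have "(\<lambda>\<omega>. h (?S \<omega>) * e (toss (n + 3) \<omega>)) =
      (\<lambda>\<omega>. (\<lambda>s. h (restrict s {3..<n + 3}) * e (s (n + 3))) (restrict (\<lambda>i. toss i \<omega>) {3..n + 3}))"
      by (auto simp: restrict_def fun_eq_iff intro!: arg_cong[where f = h])
    then show ?thesis
      using prefix_integrable[of "{3..n + 3}" "\<lambda>s. h (restrict s {3..<n + 3}) * e (s (n + 3))"] by simp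
  qed
  have int': "integrable M (\<lambda>\<omega>. h (?S \<omega>))" for h :: "_ \<Rightarrow> real"
    by (rule prefix_integrable) auto
  have "expectation (\<lambda>\<omega>. E j (state v (\<lambda>i. toss i \<omega>) (Suc n))) =
    expectation (\<lambda>\<omega>. ?hp (?S \<omega>) * ?ep (toss (n + 3) \<omega>) + ?hm (?S \<omega>) * ?em (toss (n + 3) \<omega>))"
    by (rule Bochner_Integration.integral_cong) (auto simp: state_restrict)
  also have "\<dots> = expectation (\<lambda>\<omega>. ?hp (?S \<omega>) * ?ep (toss (n + 3) \<omega>)) + expectation (\<lambda>\<omega>. ?hm (?S \<omega>) * ?em (toss (n + 3) \<omega>))"
    by (rule Bochner_Integration.integral_add[OF int int])
  also have "\<dots> = p * expectation (\<lambda>\<omega>. ?hp (?S \<omega>)) + q * expectation (\<lambda>\<omega>. ?hm (?S \<omega>))"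
    using prefix_independent[of ?hp n ?ep] prefix_independent[of ?hm n ?em]
    by (simp only: if_True if_False mult_1_right mult_zero_right add_0_right add_0_left mult_1_left mult_zero_left mult.commute)
  also have "\<dots> = expectation (\<lambda>\<omega>. p * ?hp (?S \<omega>) + q * ?hm (?S \<omega>))"
    using int'[of ?hp] int'[of ?hm] by simp
  also have "\<dots> = expectation (\<lambda>\<omega>. E (Suc j) (state v (\<lambda>i. toss i \<omega>) n))"
    by (simp add: state_restrict)
  also have "\<dots> = E (Suc n + j) v" by (subst Suc) simp
  finally show ?case .
qed

end

theorem theorem1:
  fixes M :: "'a measure" and g :: "nat \<Rightarrow> 'a \<Rightarrow> real" and m :: "nat \<Rightarrow> real"
    and p q :: real and k :: nat
  assumes "0 \<le> p" and "p \<le> 1" and "q = 1 - p" and "3 \<le> k"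
    and "random_fibonacci M p (fib_lambda k) g"
    and "\<And>n. m n = prob_space.expectation M (g n)"
  shows "(p > fib_crit k \<longrightarrow>
           (\<exists>\<alpha>. {x. 0 < x \<and> poly (fib_poly k p) x = 0} = {\<alpha>} \<and>
             (\<lambda>n. m (n + 1) / m n) \<longlonglongrightarrow> \<alpha> * (1 + p * q ^ (k - 1) / \<alpha> ^ k) \<and>
             \<alpha> * (1 + p * q ^ (k - 1) / \<alpha> ^ k) > 1)) \<and>
         (p = fib_crit k \<longrightarrow> m \<in> O(\<lambda>n. real n)) \<and>
         (p < fib_crit k \<longrightarrow> bounded (m ` {1..}))"
proof -
  obtain x y toss where ps: "prob_space M" and xy: "0 < x" "0 < y" "\<And>\<omega>. \<omega> \<in> space M \<Longrightarrow> g 1 \<omega> = x \<and> g 2 \<omega> = y"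
    and toss: "prob_space.indep_vars M (\<lambda>_. count_space UNIV) toss {3..}"
      "\<And>n. 3 \<le> n \<Longrightarrow> measure M {\<omega> \<in> space M. toss n \<omega>} = p"
    and rec: "\<And>n \<omega>. 3 \<le> n \<Longrightarrow> \<omega> \<in> space M \<Longrightarrow> g n \<omega> =
        (if toss n \<omega> then \<bar>fib_lambda k * g (n - 1) \<omega> + g (n - 2) \<omega>\<bar>
         else \<bar>fib_lambda k * g (n - 1) \<omega> - g (n - 2) \<omega>\<bar>)"
    using assms(5) unfolding random_fibonacci_def by blast
  interpret fib: fib p q "fib_lambda k" "p * q ^ (k - 1)" k
    using assms by unfold_locales auto
  interpret prob_space M by fact
  interpret W: fib_walk p q "fib_lambda k" "p * q ^ (k - 1)" k M toss
    using toss by unfold_locales auto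
  let ?v = "(x, y)"
  have v: "?v \<in> fib.quadrant" "0 < snd ?v" using xy by (auto simp: fib.quadrant_def)
  have state: "fib.state ?v (\<lambda>i. toss i \<omega>) n = (g (n + 1) \<omega>, g (n + 2) \<omega>)" if "\<omega> \<in> space M" for n \<omega>
  proof (induction n)
    case 0
    then show ?case using xy(3)[OF that] by (simp add: numeral_2_eq_2)
  next
    case (Suc n)
    have "(g (n + 1) \<omega>, g (n + 2) \<omega>) \<in> fib.quadrant"
      using fib.state_quadrant[OF v(1)] Suc by metis
    \<comment> \<open>Nonnegativity removes the absolute value in the \<open>+\<close> case, which
      \<open>plus_step\<close> omits.\<close>
    then have "0 \<le> fib_lambda k * g (n + 2) \<omega> + g (n + 1) \<omega>"
      using fib.lam_ge1 by (auto simp: fib.quadrant_def intro!: add_nonneg_nonneg mult_nonneg_nonneg)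
    then show ?case
      using Suc rec[of "n + 3", OF _ that]
      by (simp add: fib.plus_step_def fib.minus_step_def numeral_2_eq_2 numeral_3_eq_3)
  qed
  have mE: "m (n + 2) = fib.E n ?v" for n
  proof -
    have "m (n + 2) = expectation (\<lambda>\<omega>. fib.E 0 (fib.state ?v (\<lambda>i. toss i \<omega>) n))"
      unfolding assms(6) by (rule Bochner_Integration.integral_cong) (simp_all add: state)
    then show ?thesis using W.expectation_E[of 0 ?v n] by simp
  qed
  have super: "\<exists>\<alpha>. {x. 0 < x \<and> poly (fib_poly k p) x = 0} = {\<alpha>} \<and>
      (\<lambda>n. m (n + 1) / m n) \<longlonglongrightarrow> \<alpha> * (1 + p * q ^ (k - 1) / \<alpha> ^ k) \<and>
      \<alpha> * (1 + p * q ^ (k - 1) / \<alpha> ^ k) > 1" if pc: "p > fib_crit k"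
  proof -
    obtain t where t: "0 < t" "fib.D t = 0" "1 < (1 + p * q ^ (k - 1) * t ^ k) / t"
      "(\<lambda>n. fib.E (Suc n) ?v / fib.E n ?v) \<longlonglongrightarrow> (1 + p * q ^ (k - 1) * t ^ k) / t"
      using fib.supercritical_growth[OF pc v] by blast
    have "{x. 0 < x \<and> poly (fib_poly k p) x = 0} = {1 / t}"
      using fib.pos_roots[of t] t fib.fib_crit_pos pc by simp
    moreover have eq: "(1 / t) * (1 + p * q ^ (k - 1) / (1 / t) ^ k) = (1 + p * q ^ (k - 1) * t ^ k) / t"
      using t by (simp add: power_one_over)
    moreover have "(\<lambda>n. m (n + 1) / m n) \<longlonglongrightarrow> (1 + p * q ^ (k - 1) * t ^ k) / t"
    proof (rule LIMSEQ_offset[where k = 2])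
      have "m (n + 2 + 1) = fib.E (Suc n) ?v" for n using mE[of "Suc n"] by simp
      then show "(\<lambda>n. m (n + 2 + 1) / m (n + 2)) \<longlonglongrightarrow> (1 + p * q ^ (k - 1) * t ^ k) / t"
        using t(4) by (simp only: mE)
    qed
    ultimately show ?thesis using t(3) by (intro exI[of _ "1 / t"]) (simp only: eq)
  qed
  have m_nonneg: "0 \<le> m n" if "1 \<le> n" for n
  proof -
    have "0 \<le> g n \<omega>" if "\<omega> \<in> space M" for \<omega>
      using fib.state_quadrant[OF v(1), of "\<lambda>i. toss i \<omega>" "n - 1"] state[OF that, of "n - 1"] \<open>1 \<le> n\<close>
      by (simp add: fib.quadrant_def)
    then show ?thesis unfolding assms(6) by (intro integral_nonneg_AE AE_I2)
  qed
  have crit: "m \<in> O(\<lambda>n. real n)" if pc: "p = fib_crit k"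
  proof -
    obtain B where B: "\<And>n. fib.E n ?v \<le> B * (real n + 1)"
      using fib.subcritical_growth[OF eq_refl[OF pc] v(1)] by blast
    have "eventually (\<lambda>n. norm (m n) \<le> B * norm (real n)) sequentially"
      using eventually_ge_at_top[of 2]
    proof eventually_elim
      case (elim n)
      have B0: "0 \<le> B" using B[of 0] v by simp
      have "n - 2 + 2 = n" using elim by simp
      then have "m n = fib.E (n - 2) ?v" using mE[of "n - 2"] by metis
      then have "m n \<le> B * (real (n - 2) + 1)" using B[of "n - 2"] by simp
      also have "\<dots> \<le> B * real n" using elim B0 by (intro mult_left_mono) auto
      finally show ?case using m_nonneg[of n] elim by simp
    qed
    then show ?thesis by (rule bigoI)
  qed
  have sub: "bounded (m ` {1..})" if pc: "p < fib_crit k"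
  proof -
    obtain B where B: "\<And>n. fib.E n ?v \<le> B"
      using fib.subcritical_growth[OF less_imp_le[OF pc] v(1)] pc by blast
    \<comment> \<open>\<open>mE\<close> starts at index 2, so \<open>m 1\<close> enters the bound
      separately.\<close>
    have "norm (m n) \<le> max B (m 1)" if "1 \<le> n" for n
    proof (cases "n = 1")
      case False
      then have "n - 2 + 2 = n" using that by simp
      then have "m n = fib.E (n - 2) ?v" using mE[of "n - 2"] by metis
      then have "m n \<le> B" using B[of "n - 2"] by simp
      then show ?thesis using m_nonneg[OF that] by simp
    qed (use m_nonneg[of 1] in simp)
    then show ?thesis unfolding bounded_iff by blast
  qed
  show ?thesis using super crit sub by blast
qed

end
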